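(* Let $\mathcal{Z}\subset\mathbb{R}^n\times\mathbb{R}^m$ be a polytope and suppose $J:\mathcal{Z}\to\mathbb{R}$ is strictly convex and continuous piecewise quadratic on a polytopic partition $\{P_i^{\mathcal{Z}}\mid i\in\mathcal{J}^{\mathcal{Z}}\}$ of $\mathcal{Z}$, where each $P_i^{\mathcal{Z}}$ has a non-empty interior. Let $\mathcal{X}=\mathrm{Proj}_X\mathcal{Z}$ and, for $x\in\mathcal{X}$, let $V^0(x)=\min_u\{J(x,u)\mid (x,u)\in\mathcal{Z}\}$ and $\kappa(x)=\arg\min_u\{J(x,u)\mid (x,u)\in\mathcal{Z}\}$. Then $V^0$ is strictly convex and continuous piecewise quadratic on a polytopic partition $\{P_i^{\mathcal{X}}\mid i\in\mathcal{J}^{\mathcal{X}}\}$ of $\mathcal{X}$, and the minimizer $\kappa$ is piecewise affine on this same partition. Each polytope $P_i^{\mathcal{X}}$ of this partition is of the form $X(\bar x)$ for some $\bar x\in\mathcal{X}$ (with $X(\bar x)$ as defined in the context), and for such $\bar x$ one has $V^0(x)=V^0_{\bar x}(x)$ and $\kappa(x)=\kappa_{\bar x}(x)$ for all $x\in X(\bar x)$.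
   Context: A polyhedron is a set described by finitely many (affine, non-strict) inequalities; a polytope is a bounded polyhedron. For $Z\subseteq\mathbb{R}^n\times\mathbb{R}^m$, $\mathrm{Proj}_X Z=\{x\in\mathbb{R}^n\mid\exists u\in\mathbb{R}^m,\ (x,u)\in Z\}$. A polytopic partition of a compact set $\mathcal{Y}$ is a finite family $\{P_i\}_{i\in\mathcal{J}}$ of polytopes with non-empty, pairwise disjoint interiors and $\mathcal{Y}=\bigcup_iP_i$. A function on $\mathcal{Y}$ is continuous piecewise quadratic on the partition if it is continuous and on each $P_i$ equals $\frac12 x'Q_ix+q_i'x+r_i$ for some $Q_i,q_i,r_i$; a map is piecewise affine on the partition if it is continuous and on each $P_i$ equals $K_ix+k_i$ for some $K_i,k_i$. Let $J_i$ denote the quadratic function on $\mathbb{R}^n\times\mathbb{R}^m$ that coincides with $J$ on $P_i^{\mathcal{Z}}$. Active polytopes: $S^{\mathcal{Z}}(z)=\{i\in\mathcal{J}^{\mathcal{Z}}\mid z\in P_i^{\mathcal{Z}}\}$ and $S^0_{\mathcal{Z}}(x)=S^{\mathcal{Z}}(x,\kappa(x))$. Each $P_i^{\mathcal{Z}}$ is written $\{(x,u)\mid M_iu\le N_ix+p_i\}$, with $M_i,N_i,p_i$ having $r_i$ rows; a superscript $j$ denotes the $j$-th row. The subproblem with index $i$ has value and solution $$V_i^0(x)=\min_u\{J_i(x,u)\mid (x,u)\in P_i^{\mathcal{Z}}\},\qquad \kappa_i(x)=\arg\min_u\{J_i(x,u)\mid (x,u)\in P_i^{\mathcal{Z}}\},\qquad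 x\in\mathrm{Proj}_XP_i^{\mathcal{Z}},$$ and active constraint set $I_i^0(x)=\{j\in\{1,\dots,r_i\}\mid M_i^j\kappa_i(x)=N_i^jx+p_i^j\}$. For $I\subseteq\{1,\dots,r_i\}$, $\kappa_{i,I}(x)=K_{i,I}x+k_{i,I}$ denotes the (affine) solution of the equality constrained problem $\min_u\{J_i(x,u)\mid M_i^ju=N_i^jx+p_i^j,\ j\in I\}$ (for $x$ at which its constraints are feasible), $M_i^I$ is the matrix with rows $M_i^j$, $j\in I$, $PC_{i,I}=\{(M_i^I)'\lambda\mid\lambda\ge0\}\subseteq\mathbb{R}^m$, and $$X_{i,I}=\{x\in\mathcal{X}\mid M_i^j\kappa_{i,I}(x)\le N_i^jx+p_i^j,\ j\in\{1,\dots,r_i\}\setminus I;\ -\nabla_uJ_i(x,\kappa_{i,I}(x))\in PC_{i,I}\}.$$ For $\bar x\in\mathcal{X}$ and $i\in S^0_{\mathcal{Z}}(\bar x)$ put $X_i(\bar x)=X_{i,I_i^0(\bar x)}$ and $X(\bar x)=\bigcap\{X_i(\bar x)\mid i\in S^0_{\mathcal{Z}}(\bar x)\}$. The functions $V^0_{\bar x},\kappa_{\bar x}$ are defined on $X(\bar x)$ by $V^0_{\bar x}(x)=V_i^0(x)$ and $\kappa_{\bar x}(x)=\kappa_i(x)$ for all $i\in S^0_{\mathcal{Z}}(\bar x)$ (the values for different such $i$ coincide). *)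

theory Defs
  imports "HOL-Analysis.Analysis"
begin

definition Proj_X :: "('a \<times> 'b) set \<Rightarrow> 'a set"
  where "Proj_X Z = {x. \<exists>u. (x, u) \<in> Z}"

definition strictly_convex_on :: "'a::real_vector set \<Rightarrow> ('a \<Rightarrow> real) \<Rightarrow> bool"
  where "strictly_convex_on S f \<longleftrightarrow> convex S \<and>
    (\<forall>x\<in>S. \<forall>y\<in>S. \<forall>t. x \<noteq> y \<longrightarrow> 0 < t \<longrightarrow> t < 1 \<longrightarrow>
      f ((1 - t) *\<^sub>R x + t *\<^sub>R y) < (1 - t) * f x + t * f y)"

(* On a Euclidean space, matrices are represented by linear maps, so that the same definition
   serves for functions of x and for functions of (x, u). *)
definition quadratic_fun :: "('a::euclidean_space \<Rightarrow> real) \<Rightarrow> bool"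
  where "quadratic_fun f \<longleftrightarrow>
    (\<exists>Q q r. linear Q \<and> (\<forall>x. f x = 1 / 2 * (x \<bullet> Q x) + q \<bullet> x + r))"

definition affine_fun :: "('a::euclidean_space \<Rightarrow> 'b::euclidean_space) \<Rightarrow> bool"
  where "affine_fun f \<longleftrightarrow> (\<exists>K k. linear K \<and> (\<forall>x. f x = K x + k))"

(* The library's polytopes are the bounded polyhedra, by polytope_eq_bounded_polyhedron. *)
definition polytopic_partition :: "'a::euclidean_space set \<Rightarrow> 'i set \<Rightarrow> ('i \<Rightarrow> 'a set) \<Rightarrow> bool"
  where "polytopic_partition Y I P \<longleftrightarrow>
    compact Y \<and> finite I \<and>
    (\<forall>i\<in>I. polytope (P i) \<and> interior (P i) \<noteq> {}) \<and>
    (\<forall>i\<in>I. \<forall>j\<in>I. i \<noteq> j \<longrightarrow> interior (P i) \<inter> interior (P j) = {}) \<and>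
    Y = (\<Union>i\<in>I. P i)"

definition piecewise_quadratic_on ::
    "'a::euclidean_space set \<Rightarrow> 'i set \<Rightarrow> ('i \<Rightarrow> 'a set) \<Rightarrow> ('a \<Rightarrow> real) \<Rightarrow> bool"
  where "piecewise_quadratic_on Y I P f \<longleftrightarrow> continuous_on Y f \<and>
    (\<forall>i\<in>I. \<exists>g. quadratic_fun g \<and> (\<forall>x\<in>P i. f x = g x))"

definition piecewise_affine_on ::
    "'a::euclidean_space set \<Rightarrow> 'i set \<Rightarrow> ('i \<Rightarrow> 'a set) \<Rightarrow> ('a \<Rightarrow> 'b::euclidean_space) \<Rightarrow> bool"
  where "piecewise_affine_on Y I P f \<longleftrightarrow> continuous_on Y f \<and>
    (\<forall>i\<in>I. \<exists>g. affine_fun g \<and> (\<forall>x\<in>P i. f x = g x))"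

(* Minimum and minimizer over u of F (x, u) subject to (x, u) in Z; the first is meaningful
   where the minimum is attained, the second where the minimizer is moreover unique. *)
definition min_u :: "('a \<times> 'b \<Rightarrow> real) \<Rightarrow> ('a \<times> 'b) set \<Rightarrow> 'a \<Rightarrow> real"
  where "min_u F Z x = (LEAST v. v \<in> (\<lambda>u. F (x, u)) ` {u. (x, u) \<in> Z})"

definition argmin_u :: "('a \<times> 'b \<Rightarrow> real) \<Rightarrow> ('a \<times> 'b) set \<Rightarrow> 'a \<Rightarrow> 'b"
  where "argmin_u F Z x = arg_min_on (\<lambda>u. F (x, u)) {u. (x, u) \<in> Z}"

definition grad_u :: "('a \<times> 'b \<Rightarrow> real) \<Rightarrow> 'a \<Rightarrow> 'b \<Rightarrow> 'b::real_inner"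
  where "grad_u F x u = (THE g. GDERIV (\<lambda>v. F (x, v)) u :> g)"

(* In the following, the matrices M, N and the vector p of a system M u <= N x + p with r rows
   are given by their rows M j, N j and entries p j, where j = 1, ..., r. *)

definition ineq_set :: "(nat \<Rightarrow> 'b) \<Rightarrow> (nat \<Rightarrow> 'a) \<Rightarrow> (nat \<Rightarrow> real) \<Rightarrow> nat
    \<Rightarrow> ('a::real_inner \<times> 'b::real_inner) set"
  where "ineq_set M N p r = {(x, u). \<forall>j\<in>{1..r}. M j \<bullet> u \<le> N j \<bullet> x + p j}"

definition eq_set :: "(nat \<Rightarrow> 'b) \<Rightarrow> (nat \<Rightarrow> 'a) \<Rightarrow> (nat \<Rightarrow> real) \<Rightarrow> nat set
    \<Rightarrow> ('a::real_inner \<times> 'b::real_inner) set"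
  where "eq_set M N p I = {(x, u). \<forall>j\<in>I. M j \<bullet> u = N j \<bullet> x + p j}"

(* I_i^0(x) for J_i = F and P_i = ineq_set M N p r *)
definition active_constraints :: "('a \<times> 'b \<Rightarrow> real) \<Rightarrow> (nat \<Rightarrow> 'b::real_inner) \<Rightarrow> (nat \<Rightarrow> 'a)
    \<Rightarrow> (nat \<Rightarrow> real) \<Rightarrow> nat \<Rightarrow> 'a::real_inner \<Rightarrow> nat set"
  where "active_constraints F M N p r x =
    {j \<in> {1..r}. M j \<bullet> argmin_u F (ineq_set M N p r) x = N j \<bullet> x + p j}"

definition PC :: "(nat \<Rightarrow> 'b::real_vector) \<Rightarrow> nat set \<Rightarrow> 'b set"
  where "PC M I = {\<Sum>j\<in>I. l j *\<^sub>R M j | l. \<forall>j\<in>I. 0 \<le> l j}"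

(* kappa_{i,I}(x) *)
definition eq_solution :: "('a \<times> 'b \<Rightarrow> real) \<Rightarrow> (nat \<Rightarrow> 'b) \<Rightarrow> (nat \<Rightarrow> 'a)
    \<Rightarrow> (nat \<Rightarrow> real) \<Rightarrow> nat set \<Rightarrow> 'a::real_inner \<Rightarrow> 'b::real_inner"
  where "eq_solution F M N p I = argmin_u F (eq_set M N p I)"

(* X_{i,I} as a subset of X. If the rows M j with j in I are linearly dependent, the equality
   constraints need not be feasible at every x; kappa_{i,I} is defined only where they are, which
   is the condition x in Proj_X (eq_set M N p I). *)
definition X_I :: "'a set \<Rightarrow> ('a \<times> 'b \<Rightarrow> real) \<Rightarrow> (nat \<Rightarrow> 'b::real_inner) \<Rightarrow> (nat \<Rightarrow> 'a)
    \<Rightarrow> (nat \<Rightarrow> real) \<Rightarrow> nat \<Rightarrow> nat set \<Rightarrow> 'a::real_inner set"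
  where "X_I X F M N p r I =
    {x \<in> X. x \<in> Proj_X (eq_set M N p I) \<and>
      (\<forall>j\<in>{1..r} - I. M j \<bullet> eq_solution F M N p I x \<le> N j \<bullet> x + p j) \<and>
      - grad_u F x (eq_solution F M N p I x) \<in> PC M I}"

definition active_polytopes :: "'i set \<Rightarrow> ('i \<Rightarrow> 'z set) \<Rightarrow> 'z \<Rightarrow> 'i set"
  where "active_polytopes IZ P z = {i \<in> IZ. z \<in> P i}"

(* S^0_Z(x) *)
definition S0 :: "('a \<times> 'b \<Rightarrow> real) \<Rightarrow> ('a \<times> 'b) set \<Rightarrow> 'i set \<Rightarrow> ('i \<Rightarrow> ('a \<times> 'b) set)
    \<Rightarrow> 'a \<Rightarrow> 'i set"
  where "S0 J Z IZ P x = active_polytopes IZ P (x, argmin_u J Z x)"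

(* X(xb), where F i is the quadratic function J_i *)
definition X_at :: "('a \<times> 'b \<Rightarrow> real) \<Rightarrow> ('a \<times> 'b) set \<Rightarrow> 'i set \<Rightarrow> ('i \<Rightarrow> ('a \<times> 'b) set)
    \<Rightarrow> ('i \<Rightarrow> 'a \<times> 'b \<Rightarrow> real) \<Rightarrow> ('i \<Rightarrow> nat \<Rightarrow> 'b::real_inner) \<Rightarrow> ('i \<Rightarrow> nat \<Rightarrow> 'a) \<Rightarrow> ('i \<Rightarrow> nat \<Rightarrow> real)
    \<Rightarrow> ('i \<Rightarrow> nat) \<Rightarrow> 'a::real_inner \<Rightarrow> 'a set"
  where "X_at J Z IZ P F M N p r xb =
    (\<Inter>i\<in>S0 J Z IZ P xb.
      X_I (Proj_X Z) (F i) (M i) (N i) (p i) (r i)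
        (active_constraints (F i) (M i) (N i) (p i) (r i) xb))"

(* V^0_xb(x) and kappa_xb(x): the common value over i in S^0_Z(xb) *)
definition V_at :: "('a \<times> 'b \<Rightarrow> real) \<Rightarrow> ('a \<times> 'b) set \<Rightarrow> 'i set \<Rightarrow> ('i \<Rightarrow> ('a \<times> 'b) set)
    \<Rightarrow> ('i \<Rightarrow> 'a \<times> 'b \<Rightarrow> real) \<Rightarrow> 'a \<Rightarrow> 'a \<Rightarrow> real"
  where "V_at J Z IZ P F xb x = (THE v. \<forall>i\<in>S0 J Z IZ P xb. v = min_u (F i) (P i) x)"

definition kappa_at :: "('a \<times> 'b \<Rightarrow> real) \<Rightarrow> ('a \<times> 'b) set \<Rightarrow> 'i set \<Rightarrow> ('i \<Rightarrow> ('a \<times> 'b) set)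
    \<Rightarrow> ('i \<Rightarrow> 'a \<times> 'b \<Rightarrow> real) \<Rightarrow> 'a \<Rightarrow> 'a \<Rightarrow> 'b"
  where "kappa_at J Z IZ P F xb x = (THE u. \<forall>i\<in>S0 J Z IZ P xb. u = argmin_u (F i) (P i) x)"

end

theory Submission
  imports Defs
begin

text \<open>
  The subproblems are strictly convex quadratic programs, and by the KKT conditions the optimal pairs
  \<open>(x, u)\<close> of subproblem \<open>i\<close> whose multipliers live on a fixed active set form a polyhedron
  (\<open>kkt_set\<close>), which is the graph of an affine map. A critical region \<open>X(xb)\<close> is the intersection of the
  projections of these polyhedra over the tiles active at \<open>xb\<close>, hence a polytope
  (\<open>X_I_eq_Proj_kkt_set\<close>, \<open>polytope_X_at\<close>).

  The heart of the matter is that over \<open>X(xb)\<close> the solutions of all these subproblems agree and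
  solve the full problem, although the region refers only to tiles active at \<open>xb\<close>. Let \<open>x\<close> be in
  \<open>X(xb)\<close> and move from \<open>xb\<close> to \<open>x\<close>. Each subproblem solution then follows a straight segment inside
  the minimal face of its tile around \<open>(xb, \<kappa> xb)\<close>. A geometric property of tilings of a convex set
  by polyhedra (\<open>tiles_subsetI\<close>) controls how tiles meet, even if they do so without sharing faces:
  a point that lies in the minimal face around \<open>z\<close> for each tile through it lies in all
  tiles through \<open>z\<close>.
  Applied to the true minimizer shortly after the start, it shows that the segments coincide
  (\<open>common_kkt_point\<close>). Applied once more, it shows that no other tile touches the common segment
  before its end. There the subproblem solutions are thus local minimizers of the convex function \<open>J\<close>
  over the fibre, and therefore global ones (\<open>kkt_point_optimal_before\<close>); the end follows by
  continuity (\<open>kkt_point_optimal\<close>).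

  The same argument shows that active tiles and active constraints are constant along the segment
  before its end, whence \<open>X(y) = X(xb)\<close> for every interior point \<open>y\<close> of \<open>X(xb)\<close>
  (\<open>X_at_interior\<close>). Distinct regions therefore have disjoint interiors. There are finitely many
  regions, each \<open>x\<close> lies in its own region \<open>X(x)\<close>, and the regions without interior
  points can be discarded because the projection of \<open>Z\<close> is the closure of its interior
  (\<open>Union_regions\<close>). On each region \<open>\<kappa>\<close> is affine and the value function is quadratic; continuity
  follows from the finite closed cover.
\<close>

section \<open>Unique minimizers over a fibre\<close>

text \<open>
  \<^const>\<open>argmin_u\<close> and \<^const>\<open>min_u\<close> choose values even where no minimizer exists.
  The following predicate asserts that the minimum is attained at exactly one point, and thereby
  determines both choices.
\<close>

definition sole_min :: "('a \<times> 'b \<Rightarrow> real) \<Rightarrow> ('a \<times> 'b) set \<Rightarrow> 'a \<Rightarrow> 'b \<Rightarrow> bool"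
  where "sole_min F Z x u \<longleftrightarrow> (x, u) \<in> Z \<and> (\<forall>v. (x, v) \<in> Z \<longrightarrow> v \<noteq> u \<longrightarrow> F (x, u) < F (x, v))"

lemma sole_min_argmin_u:
  assumes "sole_min F Z x u"
  shows "argmin_u F Z x = u"
  unfolding argmin_u_def arg_min_on_def mem_Collect_eq
  by (rule arg_minI[of _ u]) (use assms in \<open>auto simp: sole_min_def dest: less_asym\<close>)

lemma sole_min_is_arg_min:
  assumes "sole_min F Z x u"
  shows "is_arg_min (\<lambda>u. F (x, u)) (\<lambda>u. (x, u) \<in> Z) v \<longleftrightarrow> v = u"
  using assms by (auto simp: sole_min_def is_arg_min_def)

lemma sole_min_min_u:
  assumes "sole_min F Z x u"
  shows "min_u F Z x = F (x, u)"
  unfolding min_u_def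
  by (rule Least_equality) (use assms in \<open>auto simp: sole_min_def less_le\<close>)

lemma sole_min_unique: "sole_min F Z x u \<Longrightarrow> sole_min F Z x v \<Longrightarrow> u = v"
  using sole_min_argmin_u by metis

lemma sole_min_le: "sole_min F Z x u \<Longrightarrow> (x, v) \<in> Z \<Longrightarrow> F (x, u) \<le> F (x, v)"
  unfolding sole_min_def by (metis order.refl order_less_imp_le)

section \<open>Quadratic functions\<close>

text \<open>
  The second-order Taylor expansion, with the Hessian in the symmetrized form
  \<open>(Q + Q') / 2\<close>, since \<open>Q\<close> itself may be any linear map.
\<close>

lemma quadratic_fun_expansion:
  assumes "quadratic_fun F"
  obtains B c where "linear B"
    "\<And>z w. F (z + w) = F z + (B z + c) \<bullet> w + 1 / 2 * (w \<bullet> B w)"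
proof -
  obtain Q q r where Q: "linear Q" and F: "\<And>x. F x = 1 / 2 * (x \<bullet> Q x) + q \<bullet> x + r"
    using assms unfolding quadratic_fun_def by auto
  define B where "B = (\<lambda>x. (1 / 2) *\<^sub>R (Q x + adjoint Q x))"
  have "linear B"
    unfolding B_def using Q adjoint_linear[OF Q]
    by (intro linear_compose_scale_right linear_compose_add)
  moreover have "F (z + w) = F z + (B z + q) \<bullet> w + 1 / 2 * (w \<bullet> B w)" for z w
    unfolding B_def F using adjoint_works[OF Q, of w z] adjoint_works[OF Q, of w w]
    by (simp add: linear_add[OF Q] inner_commute algebra_simps)
  ultimately show ?thesis using that by blast
qed

lemma quadratic_fun_affine_compose:
  fixes F :: "'b::euclidean_space \<Rightarrow> real" and A :: "'a::euclidean_space \<Rightarrow> 'b"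
  assumes "quadratic_fun F" "linear A"
  shows "quadratic_fun (\<lambda>x. F (A x + b))"
proof -
  obtain B c where B: "linear B"
    and ex: "\<And>z w. F (z + w) = F z + (B z + c) \<bullet> w + 1 / 2 * (w \<bullet> B w)"
    using assms(1) by (rule quadratic_fun_expansion) blast
  have "F (A x + b) = 1 / 2 * (x \<bullet> (adjoint A \<circ> B \<circ> A) x) + adjoint A (B b + c) \<bullet> x + F b" for x
    using ex[of b "A x"] adjoint_clauses(2)[OF assms(2), of "B b + c" x]
      adjoint_clauses(1)[OF assms(2), of x "B (A x)"]
    by (simp add: add.commute[of b "A x"])
  moreover have "linear (adjoint A \<circ> B \<circ> A)"
    by (intro linear_compose B assms(2) adjoint_linear)
  ultimately show ?thesis unfolding quadratic_fun_def
    by (intro exI[of _ "adjoint A \<circ> B \<circ> A"] exI[of _ "adjoint A (B b + c)"] exI[of _ "F b"]) simp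
qed

text \<open>
  The direction space of such a set meets \<open>{0} \<times> UNIV\<close> only in \<open>0\<close>, so the first projection is
  injective on it and has a linear left inverse, whose second component is the slope.
  This turns optimality systems into explicit affine solution maps.
\<close>

lemma affine_set_as_graph:
  fixes A :: "('a::euclidean_space \<times> 'b::euclidean_space) set"
  assumes "affine A" and uniq: "\<And>x u v. (x, u) \<in> A \<Longrightarrow> (x, v) \<in> A \<Longrightarrow> u = v"
  obtains g where "affine_fun g" "\<And>x u. (x, u) \<in> A \<Longrightarrow> u = g x"
proof (cases "A = {}")
  case True
  have "affine_fun (\<lambda>x. 0 :: 'b)"
    unfolding affine_fun_def by (intro exI[of _ "\<lambda>x. 0"] exI[of _ 0]) (simp add: linear_zero)
  then show ?thesis using that True by blast
next
  case False
  then obtain x0 u0 where a: "(x0, u0) \<in> A" by auto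
  define L where "L = (\<lambda>z. - (x0, u0) + z) ` A"
  have sub: "subspace L" unfolding L_def by (rule affine_diffs_subspace[OF assms(1) a])
  have shift: "z \<in> L \<longleftrightarrow> (x0, u0) + z \<in> A" for z
  proof
    assume "z \<in> L"
    then obtain y where "y \<in> A" "z = - (x0, u0) + y" unfolding L_def by blast
    then show "(x0, u0) + z \<in> A" by (simp only: add_minus_cancel)
  next
    assume "(x0, u0) + z \<in> A"
    then have "- (x0, u0) + ((x0, u0) + z) \<in> L" unfolding L_def by (rule imageI)
    then show "z \<in> L" by (simp only: minus_add_cancel)
  qed
  have inj: "inj_on fst L"
  proof (rule inj_onI)
    fix z w assume "z \<in> L" "w \<in> L" and eq: "fst z = fst w"
    then have "(x0 + fst z, u0 + snd z) \<in> A" "(x0 + fst z, u0 + snd w) \<in> A"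
      using shift[of z] shift[of w] by (simp_all add: plus_prod_def)
    from uniq[OF this] eq show "z = w" by (simp add: prod_eq_iff)
  qed
  obtain h where h: "linear h" "\<And>z. z \<in> L \<Longrightarrow> h (fst z) = z"
    using linear_exists_left_inverse_on[OF linear_fst sub inj] by auto
  define g where "g x = snd (h x) + (u0 - snd (h x0))" for x
  have "linear (\<lambda>x. snd (h x))" using linear_compose[OF h(1) linear_snd] by (simp add: comp_def)
  then have "affine_fun g" unfolding affine_fun_def g_def
    by (intro exI[of _ "\<lambda>x. snd (h x)"] exI[of _ "u0 - snd (h x0)"]) simp
  moreover have "u = g x" if "(x, u) \<in> A" for x u
  proof -
    have "(x - x0, u - u0) \<in> L" using that shift by simp
    then have "h (x - x0) = (x - x0, u - u0)" using h(2) by fastforce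
    then have "snd (h x) - snd (h x0) = u - u0"
      by (metis h(1) linear_diff snd_conv snd_diff)
    then show ?thesis unfolding g_def by (simp add: algebra_simps)
  qed
  ultimately show ?thesis using that by blast
qed

section \<open>Finitely generated cones and affine preimages of polyhedra\<close>

text \<open>
  Finitely generated convex cones are polyhedra. In particular they are closed, on which Farkas'
  lemma rests.
\<close>

lemma PC_eq_convex_cone_hull:
  assumes "finite I"
  shows "PC M I = convex_cone hull (M ` I)"
proof
  show "PC M I \<subseteq> convex_cone hull (M ` I)"
  proof
    fix y assume "y \<in> PC M I"
    then obtain l where y: "y = (\<Sum>j\<in>I. l j *\<^sub>R M j)" and l: "\<forall>j\<in>I. 0 \<le> l j"
      unfolding PC_def by blast
    have "(\<Sum>j\<in>J. l j *\<^sub>R M j) \<in> convex_cone hull (M ` I)" if "J \<subseteq> I" for J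
      using finite_subset[OF that assms] that
    proof (induction J rule: finite_induct)
      case empty then show ?case by (simp add: convex_cone_hull_contains_0)
    next
      case (insert j J)
      have "M j \<in> convex_cone hull (M ` I)" using insert.prems by (intro hull_inc) auto
      then show ?case using insert l by (auto intro!: convex_cone_hull_add convex_cone_hull_mul)
    qed
    then show "y \<in> convex_cone hull (M ` I)" using y by simp
  qed
next
  have "convex_cone (PC M I)"
    unfolding convex_cone_iff
  proof (intro conjI ballI allI impI)
    show "0 \<in> PC M I" unfolding PC_def by (auto intro: exI[of _ "\<lambda>j. 0"])
  next
    fix x y assume "x \<in> PC M I" "y \<in> PC M I"
    then obtain l l' where "x = (\<Sum>j\<in>I. l j *\<^sub>R M j)" "\<forall>j\<in>I. 0 \<le> l j"
      "y = (\<Sum>j\<in>I. l' j *\<^sub>R M j)" "\<forall>j\<in>I. 0 \<le> l' j" unfolding PC_def by blast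
    then have "x + y = (\<Sum>j\<in>I. (l j + l' j) *\<^sub>R M j)" "\<forall>j\<in>I. 0 \<le> l j + l' j"
      by (auto simp: sum.distrib scaleR_left_distrib)
    then show "x + y \<in> PC M I" unfolding PC_def by (auto intro: exI[of _ "\<lambda>j. l j + l' j"])
  next
    fix x and a :: real assume "x \<in> PC M I" "0 \<le> a"
    then obtain l where "x = (\<Sum>j\<in>I. l j *\<^sub>R M j)" "\<forall>j\<in>I. 0 \<le> l j" unfolding PC_def by blast
    then have "a *\<^sub>R x = (\<Sum>j\<in>I. (a * l j) *\<^sub>R M j)" "\<forall>j\<in>I. 0 \<le> a * l j"
      using \<open>0 \<le> a\<close> by (auto simp: scaleR_sum_right)
    then show "a *\<^sub>R x \<in> PC M I" unfolding PC_def by (auto intro: exI[of _ "\<lambda>j. a * l j"])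
  qed
  moreover have "M ` I \<subseteq> PC M I"
  proof
    fix y assume "y \<in> M ` I"
    then obtain i where i: "i \<in> I" "y = M i" by blast
    have "M i = (\<Sum>j\<in>I. (if j = i then 1 else 0) *\<^sub>R M j)"
      using i(1) assms by (simp add: if_distrib[of "\<lambda>x. x *\<^sub>R _"] sum.delta cong: if_cong)
    then show "y \<in> PC M I"
      unfolding PC_def i(2) by (auto intro!: exI[of _ "\<lambda>j. if j = i then 1 else 0"])
  qed
  ultimately show "convex_cone hull (M ` I) \<subseteq> PC M I" by (simp add: hull_minimal)
qed

lemma polyhedron_PC:
  fixes M :: "nat \<Rightarrow> 'b::euclidean_space"
  assumes "finite I"
  shows "polyhedron (PC M I)"
  using assms by (simp add: PC_eq_convex_cone_hull polyhedron_convex_cone_hull)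

text \<open>
  Farkas' lemma: a hyperplane that strictly separates a point from a closed cone can be moved to
  the apex of the cone.
\<close>

lemma PC_alternative:
  fixes M :: "nat \<Rightarrow> 'b::euclidean_space"
  assumes "finite I" "g \<notin> PC M I"
  obtains w where "0 < w \<bullet> g" "\<And>j. j \<in> I \<Longrightarrow> w \<bullet> M j \<le> 0"
proof -
  have poly: "polyhedron (PC M I)" using assms(1) by (rule polyhedron_PC)
  have cone: "convex_cone (PC M I)"
    using assms(1) by (simp add: PC_eq_convex_cone_hull convex_cone_convex_cone_hull)
  obtain a b where ab: "a \<bullet> g < b" "\<And>y. y \<in> PC M I \<Longrightarrow> b < a \<bullet> y"
    using separating_hyperplane_closed_point[OF polyhedron_imp_convex polyhedron_imp_closed assms(2)]
      poly by blast
  have "b < 0" using ab(2)[OF convex_cone_contains_0[OF cone]] by simp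
  have "0 \<le> a \<bullet> M j" if "j \<in> I" for j
  proof (rule ccontr)
    assume neg: "\<not> 0 \<le> a \<bullet> M j"
    have "M j \<in> PC M I" using that assms(1) by (simp add: PC_eq_convex_cone_hull hull_inc)
    then have "(b / (a \<bullet> M j)) *\<^sub>R M j \<in> PC M I"
      using \<open>b < 0\<close> neg cone by (intro convex_cone_scaleR) (auto simp: zero_le_divide_iff)
    \<comment> \<open>This multiple of \<open>M j\<close> has inner product exactly \<open>b\<close> with \<open>a\<close>.\<close>
    from ab(2)[OF this] neg show False by simp
  qed
  then show ?thesis using that[of "- a"] ab(1) \<open>b < 0\<close> by simp
qed

lemma polyhedron_affine_preimage:
  fixes A :: "'a::euclidean_space \<Rightarrow> 'b::euclidean_space"
  assumes "polyhedron S" "linear A"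
  shows "polyhedron {z. A z + b \<in> S}"
proof -
  obtain \<H> where fin: "finite \<H>" and S: "S = \<Inter>\<H>"
    and H: "\<And>h. h \<in> \<H> \<Longrightarrow> \<exists>a \<beta>. a \<noteq> 0 \<and> h = {x. a \<bullet> x \<le> \<beta>}"
    using assms(1) unfolding polyhedron_def by metis
  have "{z. A z + b \<in> S} = (\<Inter>h\<in>\<H>. {z. A z + b \<in> h})" using S by auto
  moreover have "polyhedron {z. A z + b \<in> h}" if "h \<in> \<H>" for h
  proof -
    from H[OF that] obtain a \<beta> where h: "h = {x. a \<bullet> x \<le> \<beta>}" by blast
    have "{z. A z + b \<in> h} = {z. adjoint A a \<bullet> z \<le> \<beta> - a \<bullet> b}"
      unfolding h by (auto simp: adjoint_clauses[OF assms(2)] inner_add_right)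
    then show ?thesis by (simp add: polyhedron_halfspace_le)
  qed
  ultimately show ?thesis using fin by (auto intro: polyhedron_Inter)
qed

section \<open>Quadratic programs over the fibres of a polyhedron\<close>

lemma ineq_set_eq: "ineq_set M N p r = {z. \<forall>j\<in>{1..r}. (- N j, M j) \<bullet> z \<le> p j}"
  unfolding ineq_set_def by (auto simp: algebra_simps)

lemma eq_set_eq: "eq_set M N p I = {z. \<forall>j\<in>I. (- N j, M j) \<bullet> z = p j}"
  unfolding eq_set_def by (auto simp: algebra_simps)

lemma polyhedron_ineq_set:
  fixes M :: "nat \<Rightarrow> 'b::euclidean_space" and N :: "nat \<Rightarrow> 'a::euclidean_space"
  shows "polyhedron (ineq_set M N p r)"
proof -
  have "ineq_set M N p r = (\<Inter>j\<in>{1..r}. {z. (- N j, M j) \<bullet> z \<le> p j})"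
    unfolding ineq_set_eq by auto
  then show ?thesis by (auto intro!: polyhedron_Inter simp: polyhedron_halfspace_le)
qed

lemma polyhedron_eq_set:
  fixes M :: "nat \<Rightarrow> 'b::euclidean_space" and N :: "nat \<Rightarrow> 'a::euclidean_space"
  assumes "finite I"
  shows "polyhedron (eq_set M N p I)"
proof -
  have "eq_set M N p I = (\<Inter>j\<in>I. {z. (- N j, M j) \<bullet> z = p j})"
    unfolding eq_set_eq by auto
  then show ?thesis using assms by (auto intro!: polyhedron_Inter simp: polyhedron_hyperplane)
qed

text \<open>
  The optimal pairs \<open>(x, u)\<close> of one subproblem at which the constraints in \<open>I\<close> are active and carry
  all the multipliers. In the joint space this is a polyhedron, although the critical region
  \<^const>\<open>X_I\<close>, its projection, is defined through the solution of an optimization problem.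
\<close>

definition kkt_set :: "('a \<times> 'b \<Rightarrow> real) \<Rightarrow> (nat \<Rightarrow> 'b::real_inner) \<Rightarrow> (nat \<Rightarrow> 'a::real_inner)
    \<Rightarrow> (nat \<Rightarrow> real) \<Rightarrow> nat \<Rightarrow> nat set \<Rightarrow> ('a \<times> 'b) set"
  where "kkt_set F M N p r I =
    {z \<in> ineq_set M N p r \<inter> eq_set M N p I. - grad_u F (fst z) (snd z) \<in> PC M I}"

text \<open>
  Positive definiteness is required in the \<open>u\<close> directions only: it is what minimization over
  \<open>u\<close> with \<open>x\<close> fixed needs.
\<close>

locale fibrewise_pd_quadratic =
  fixes F :: "'a::euclidean_space \<times> 'b::euclidean_space \<Rightarrow> real" and B c
  assumes linear_B: "linear B"
    and expand: "\<And>z w. F (z + w) = F z + (B z + c) \<bullet> w + 1 / 2 * (w \<bullet> B w)"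
    and pd: "\<And>v. v \<noteq> 0 \<Longrightarrow> 0 < (0, v) \<bullet> B (0, v)"
begin

definition G :: "'a \<times> 'b \<Rightarrow> 'b" where "G z = snd (B z) + snd c"

definition H :: "'b \<Rightarrow> 'b" where "H v = snd (B (0, v))"

lemma linear_snd_B: "linear (\<lambda>z. snd (B z))"
  using linear_compose[OF linear_B linear_snd] by (simp add: comp_def)

lemma linear_H: "linear H"
proof -
  have "linear (\<lambda>v::'b. (0::'a, v))" by (rule linearI) auto
  from linear_compose[OF this linear_snd_B] show ?thesis by (simp add: comp_def H_def[abs_def])
qed

lemma bounded_linear_H: "bounded_linear H"
  using linear_H by (rule linear_conv_bounded_linear[THEN iffD1])

lemma H_pos: "v \<noteq> 0 \<Longrightarrow> 0 < v \<bullet> H v"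
  using pd[of v] by (simp add: H_def inner_prod_def)

lemma fibre_expansion: "F (x, v) = F (x, u) + G (x, u) \<bullet> (v - u) + 1 / 2 * ((v - u) \<bullet> H (v - u))"
  using expand[of "(x, u)" "(0, v - u)"] by (simp add: G_def H_def inner_prod_def)

lemma fibre_function:
  "(\<lambda>v. F (x, v)) = (\<lambda>v. F (x, u) + G (x, u) \<bullet> (v - u) + 1 / 2 * ((v - u) \<bullet> H (v - u)))"
  by (rule ext) (rule fibre_expansion)

lemma G_diff: "G (x, v) - G (x, u) = H (v - u)"
  using linear_diff[OF linear_snd_B, of "(x, v)" "(x, u)"] by (simp add: G_def H_def)

lemma grad_u_eq: "grad_u F x u = G (x, u)"
  unfolding grad_u_def
proof (rule the_equality)
  show G: "GDERIV (\<lambda>v. F (x, v)) u :> G (x, u)"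
    unfolding gderiv_def
    by (subst fibre_function[of x u], auto intro!: derivative_eq_intros bounded_linear.has_derivative[OF bounded_linear_H]
        simp: linear_0[OF linear_H] inner_commute)
  fix g assume "GDERIV (\<lambda>v. F (x, v)) u :> g"
  with G have "(\<lambda>h. h \<bullet> g) = (\<lambda>h. h \<bullet> G (x, u))"
    unfolding gderiv_def by (rule has_derivative_unique[rotated])
  then show "g = G (x, u)" by (simp add: fun_eq_iff vector_eq_ldot)
qed

text \<open>
  The hypothesis on \<open>v\<close> covers competitors that satisfy the constraints in \<open>I\<close> with equality and
  those that merely satisfy them as inequalities. So a KKT point solves the equality constrained
  and the inequality constrained problem at the same time.
\<close>

lemma kkt_strict_minimum:
  assumes "- G (x, u) \<in> PC M I" "\<And>j. j \<in> I \<Longrightarrow> M j \<bullet> v \<le> M j \<bullet> u" "v \<noteq> u"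
  shows "F (x, u) < F (x, v)"
proof -
  obtain l where l: "- G (x, u) = (\<Sum>j\<in>I. l j *\<^sub>R M j)" "\<forall>j\<in>I. 0 \<le> l j"
    using assms(1) unfolding PC_def by blast
  have "G (x, u) \<bullet> (v - u) = - ((\<Sum>j\<in>I. l j *\<^sub>R M j) \<bullet> (v - u))"
    using l(1) by (metis inner_minus_left minus_minus)
  also have "\<dots> = (\<Sum>j\<in>I. l j * (M j \<bullet> u - M j \<bullet> v))"
    by (simp add: inner_sum_left inner_diff_right algebra_simps sum_subtractf)
  also have "\<dots> \<ge> 0" using assms(2) l(2) by (intro sum_nonneg) simp
  finally show ?thesis
    using fibre_expansion[of x v u] H_pos[of "v - u"] assms(3) by simp
qed

text \<open>
  If the negative gradient is outside the cone of active normals, Farkas' lemma yields a direction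
  that violates no active constraint and along which \<open>F\<close> decreases to first order. A short
  enough step keeps the inactive constraints satisfied.
\<close>

lemma kkt_necessary:
  assumes u: "(x, u) \<in> ineq_set M N p r"
    and min: "\<And>v. (x, v) \<in> ineq_set M N p r \<Longrightarrow> F (x, u) \<le> F (x, v)"
  shows "- G (x, u) \<in> PC M {j \<in> {1..r}. M j \<bullet> u = N j \<bullet> x + p j}" (is "_ \<in> PC M ?I")
proof (rule ccontr)
  assume "- G (x, u) \<notin> PC M ?I"
  then obtain w where w: "0 < w \<bullet> - G (x, u)" "\<And>j. j \<in> ?I \<Longrightarrow> w \<bullet> M j \<le> 0"
    using PC_alternative[of ?I "- G (x, u)" M] by auto
  have "eventually (\<lambda>e. M j \<bullet> (u + e *\<^sub>R w) \<le> N j \<bullet> x + p j) (at_right 0)" if "j \<in> {1..r}" for j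
  proof (cases "j \<in> ?I")
    case True
    then show ?thesis using w(2)[OF True]
      by (auto simp: inner_add_right inner_commute mult_nonneg_nonpos eventually_at_filter)
  next
    case False
    then have "M j \<bullet> u < N j \<bullet> x + p j" using that u unfolding ineq_set_def by force
    moreover have "((\<lambda>e. M j \<bullet> (u + e *\<^sub>R w)) \<longlongrightarrow> M j \<bullet> (u + 0 *\<^sub>R w)) (at_right 0)"
      by (intro tendsto_intros)
    ultimately have "eventually (\<lambda>e. M j \<bullet> (u + e *\<^sub>R w) < N j \<bullet> x + p j) (at_right 0)"
      by (intro order_tendstoD) auto
    then show ?thesis by (rule eventually_mono) simp
  qed
  then have feas: "eventually (\<lambda>e. (x, u + e *\<^sub>R w) \<in> ineq_set M N p r) (at_right 0)"
    unfolding ineq_set_def by (simp add: eventually_ball_finite)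
  have "((\<lambda>e. G (x, u) \<bullet> w + 1 / 2 * (e * (w \<bullet> H w))) \<longlongrightarrow> G (x, u) \<bullet> w + 1 / 2 * (0 * (w \<bullet> H w)))
      (at_right (0::real))"
    by (intro tendsto_intros)
  moreover have "G (x, u) \<bullet> w < 0" using w(1) by (simp add: inner_commute)
  ultimately have "eventually (\<lambda>e. G (x, u) \<bullet> w + 1 / 2 * (e * (w \<bullet> H w)) < 0) (at_right 0)"
    by (intro order_tendstoD) auto
  then have "eventually (\<lambda>e::real. False) (at_right 0)"
    using feas eventually_at_right_less[of 0]
  proof eventually_elim
    case (elim e)
    have "F (x, u + e *\<^sub>R w) = F (x, u) + e * (G (x, u) \<bullet> w + 1 / 2 * (e * (w \<bullet> H w)))"
      using fibre_expansion[of x "u + e *\<^sub>R w" u] linear_scale[OF linear_H]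
      by (simp add: algebra_simps)
    moreover have "e * (G (x, u) \<bullet> w + 1 / 2 * (e * (w \<bullet> H w))) < 0"
      using elim by (simp add: mult_pos_neg)
    ultimately show False using min[OF elim(2)] by linarith
  qed
  then show False by simp
qed

lemma coercive:
  obtains \<mu> where "0 < \<mu>" "\<And>v. \<mu> * (norm v)\<^sup>2 \<le> v \<bullet> H v"
proof -
  have cont: "continuous_on (sphere 0 1) (\<lambda>v. v \<bullet> H v)"
    by (intro continuous_intros bounded_linear.continuous_on[OF bounded_linear_H])
  have ne: "sphere (0::'b) 1 \<noteq> {}" by simp
  obtain s where s: "s \<in> sphere 0 1" "\<And>v. v \<in> sphere 0 1 \<Longrightarrow> s \<bullet> H s \<le> v \<bullet> H v"
    using continuous_attains_inf[OF _ ne cont] by auto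
  have "s \<bullet> H s * (norm v)\<^sup>2 \<le> v \<bullet> H v" for v
  proof (cases "v = 0")
    case False
    let ?e = "v /\<^sub>R norm v"
    have "s \<bullet> H s * (norm v)\<^sup>2 \<le> (?e \<bullet> H ?e) * (norm v)\<^sup>2"
      using False by (intro mult_right_mono s(2)) auto
    also have "\<dots> = v \<bullet> H v"
      using False by (simp add: linear_scale[OF linear_H] power2_eq_square field_simps)
    finally show ?thesis .
  qed (simp add: linear_0[OF linear_H])
  moreover have "0 < s \<bullet> H s" using s(1) by (intro H_pos) auto
  ultimately show ?thesis using that by blast
qed

text \<open>
  The quadratic term dominates the linear one outside a ball around \<open>u0\<close>, so an unbounded
  feasible set, such as an affine subspace, causes no loss of the minimum.
\<close>

lemma minimum_attained:
  assumes "closed A" "(x, u0) \<in> A"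
  obtains u where "is_arg_min (\<lambda>v. F (x, v)) (\<lambda>v. (x, v) \<in> A) u"
proof -
  obtain \<mu> where \<mu>: "0 < \<mu>" "\<And>v. \<mu> * (norm v)\<^sup>2 \<le> v \<bullet> H v" by (rule coercive) blast
  have "closed ((\<lambda>v. (x, v)) -` A)"
    using assms(1) by (rule continuous_closed_vimage) (intro continuous_intros)
  then have cl: "closed {v. (x, v) \<in> A}" by (simp add: vimage_def)
  \<comment> \<open>At distance \<open>d\<close> from \<open>u0\<close> the objective grows by at least \<open>\<mu> * d\<^sup>2 / 2 - norm (G (x, u0)) * d\<close>, which is nonnegative outside this ball.\<close>
  let ?S = "{v. (x, v) \<in> A} \<inter> cball u0 (2 * norm (G (x, u0)) / \<mu>)"
  have "continuous_on ?S (\<lambda>v. F (x, v))"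
    by (subst fibre_function[of x u0])
      (intro continuous_intros bounded_linear.continuous_on[OF bounded_linear_H])
  moreover have "compact ?S" using cl by (simp add: closed_Int_compact)
  moreover have "u0 \<in> ?S" using assms(2) \<mu>(1) by simp
  ultimately obtain u where u: "u \<in> ?S" "\<And>v. v \<in> ?S \<Longrightarrow> F (x, u) \<le> F (x, v)"
    using continuous_attains_inf[of ?S "\<lambda>v. F (x, v)"] by (metis empty_iff)
  have "F (x, u) \<le> F (x, v)" if "(x, v) \<in> A" for v
  proof (cases "v \<in> ?S")
    case False
    then have "2 * norm (G (x, u0)) / \<mu> < norm (v - u0)"
      using that by (simp add: dist_norm norm_minus_commute)
    then have big: "2 * norm (G (x, u0)) \<le> \<mu> * norm (v - u0)"
      using \<mu>(1) by (simp add: field_simps)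
    have "- (G (x, u0) \<bullet> (v - u0)) \<le> norm (G (x, u0)) * norm (v - u0)"
      using Cauchy_Schwarz_ineq2[of "G (x, u0)" "v - u0"] by linarith
    also have "\<dots> \<le> 1 / 2 * (\<mu> * norm (v - u0)) * norm (v - u0)"
      using big by (intro mult_right_mono) auto
    also have "\<dots> \<le> 1 / 2 * ((v - u0) \<bullet> H (v - u0))"
      using \<mu>(2)[of "v - u0"] by (simp add: power2_eq_square)
    finally have "F (x, u0) \<le> F (x, v)" using fibre_expansion[of x v u0] by simp
    then show ?thesis using u(2)[OF \<open>u0 \<in> ?S\<close>] by linarith
  qed (use u in auto)
  then show ?thesis using that u(1) by (auto simp: is_arg_min_linorder)
qed

lemma kkt_set_sole_min:
  assumes "(x, u) \<in> kkt_set F M N p r I" "I \<subseteq> {1..r}"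
  shows "sole_min F (ineq_set M N p r) x u"
proof -
  have u: "(x, u) \<in> ineq_set M N p r" "(x, u) \<in> eq_set M N p I" "- G (x, u) \<in> PC M I"
    using assms(1) by (auto simp: kkt_set_def grad_u_eq)
  have "F (x, u) < F (x, v)" if "(x, v) \<in> ineq_set M N p r" "v \<noteq> u" for v
    using that u(2) assms(2) by (intro kkt_strict_minimum[OF u(3)]) (fastforce simp: ineq_set_def eq_set_def)
  then show ?thesis using u(1) by (simp add: sole_min_def)
qed

text \<open>
  The solution of the equality constrained problem can be replaced by any \<open>u\<close> that satisfies the
  KKT system, because the system forces \<open>u\<close> to be that solution.
\<close>

lemma X_I_eq_Proj_kkt_set:
  assumes "I \<subseteq> {1..r}"
  shows "X_I X F M N p r I = X \<inter> fst ` kkt_set F M N p r I"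
proof (intro set_eqI iffI)
  fix x assume x: "x \<in> X_I X F M N p r I"
  define u where "u = eq_solution F M N p I x"
  from x obtain u0 where "(x, u0) \<in> eq_set M N p I" by (auto simp: X_I_def Proj_X_def)
  moreover have "closed (eq_set M N p I)"
    using assms by (intro polyhedron_imp_closed polyhedron_eq_set) (rule finite_subset, auto)
  ultimately obtain u' where "is_arg_min (\<lambda>v. F (x, v)) (\<lambda>v. (x, v) \<in> eq_set M N p I) u'"
    using minimum_attained by blast
  then have "(x, u) \<in> eq_set M N p I"
    unfolding u_def eq_solution_def argmin_u_def arg_min_on_def arg_min_def mem_Collect_eq
    by (rule someI2) (simp add: is_arg_min_def)
  moreover have "(x, u) \<in> ineq_set M N p r"
    using x calculation by (auto simp: X_I_def ineq_set_def eq_set_def u_def)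
  ultimately have "(x, u) \<in> kkt_set F M N p r I"
    using x by (simp add: kkt_set_def X_I_def u_def)
  then show "x \<in> X \<inter> fst ` kkt_set F M N p r I" using x by (force simp: X_I_def)
next
  fix x assume "x \<in> X \<inter> fst ` kkt_set F M N p r I"
  then obtain u where x: "x \<in> X" and u: "(x, u) \<in> kkt_set F M N p r I" by force
  then have u': "(x, u) \<in> ineq_set M N p r" "(x, u) \<in> eq_set M N p I" "- G (x, u) \<in> PC M I"
    by (auto simp: kkt_set_def grad_u_eq)
  have "sole_min F (eq_set M N p I) x u"
    unfolding sole_min_def using u'(2)
    by (auto intro!: kkt_strict_minimum[OF u'(3)] simp: eq_set_def)
  then have "eq_solution F M N p I x = u" unfolding eq_solution_def by (rule sole_min_argmin_u)
  then show "x \<in> X_I X F M N p r I"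
    using x u' by (auto simp: X_I_def Proj_X_def grad_u_eq ineq_set_def)
qed

lemma polyhedron_kkt_set:
  assumes "finite I"
  shows "polyhedron (kkt_set F M N p r I)"
proof -
  have "linear (\<lambda>z. - snd (B z))" using linear_snd_B by (rule linear_compose_neg)
  from polyhedron_affine_preimage[OF polyhedron_PC[OF assms] this]
  have poly: "polyhedron {z. - snd (B z) + - snd c \<in> PC M I}" .
  have "kkt_set F M N p r I =
      ineq_set M N p r \<inter> eq_set M N p I \<inter> {z. - snd (B z) + - snd c \<in> PC M I}"
    by (auto simp: kkt_set_def grad_u_eq G_def)
  then show ?thesis
    by (simp only:) (intro polyhedron_Int polyhedron_ineq_set polyhedron_eq_set assms poly)
qed

text \<open>
  Relaxing the cone to its span and dropping the inequalities leaves an affine set. It is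
  single-valued in \<open>u\<close>: the difference of two solutions is orthogonal to the normals
  in \<open>I\<close>, whereas the Hessian maps it into their span.
\<close>

lemma kkt_set_affine_graph:
  assumes "finite I"
  obtains g where "affine_fun g" "\<And>x u. (x, u) \<in> kkt_set F M N p r I \<Longrightarrow> u = g x"
proof -
  let ?A = "eq_set M N p I \<inter> {z. G z \<in> span (M ` I)}"
  have "affine ?A"
    unfolding affine_def
  proof (intro ballI allI impI)
    fix z w and s t :: real assume z: "z \<in> ?A" and w: "w \<in> ?A" and st: "s + t = 1"
    have "s * b + t * b = b" for b using st by (metis distrib_right mult_1)
    then have "s *\<^sub>R z + t *\<^sub>R w \<in> eq_set M N p I"
      using z w by (simp add: eq_set_eq inner_add_right del: inner_Pair)
    moreover have "G (s *\<^sub>R z + t *\<^sub>R w) = s *\<^sub>R G z + t *\<^sub>R G w"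
      using linear_add[OF linear_snd_B] linear_scale[OF linear_snd_B] st
      by (simp add: G_def algebra_simps) (simp flip: scaleR_left_distrib)
    ultimately show "s *\<^sub>R z + t *\<^sub>R w \<in> ?A" using z w by (auto intro: span_add span_scale)
  qed
  moreover have "u = v" if u: "(x, u) \<in> ?A" and v: "(x, v) \<in> ?A" for x u v
  proof (rule ccontr)
    assume "u \<noteq> v"
    have "orthogonal (v - u) y" if "y \<in> span (M ` I)" for y
    proof (rule orthogonal_to_span[OF that])
      fix y assume "y \<in> M ` I"
      with u v show "orthogonal (v - u) y"
        by (auto simp: orthogonal_def eq_set_def inner_diff_right inner_commute[of "v - u"])
    qed
    moreover have "H (v - u) \<in> span (M ` I)" using u v G_diff[of x v u] span_diff by (metis Int_iff mem_Collect_eq)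
    ultimately have "(v - u) \<bullet> H (v - u) = 0" by (simp add: orthogonal_def)
    then show False using H_pos[of "v - u"] \<open>u \<noteq> v\<close> by simp
  qed
  ultimately obtain g where g: "affine_fun g" "\<And>x u. (x, u) \<in> ?A \<Longrightarrow> u = g x"
    using affine_set_as_graph[of ?A] by blast
  have "z \<in> ?A" if "z \<in> kkt_set F M N p r I" for z
  proof -
    have "- G z \<in> PC M I" "z \<in> eq_set M N p I"
      using that by (auto simp: kkt_set_def grad_u_eq)
    moreover have "PC M I \<subseteq> span (M ` I)"
      unfolding PC_def by (auto intro!: span_sum span_scale intro: span_base)
    ultimately show ?thesis using span_neg[of "- G z"] by auto
  qed
  then show ?thesis using that g by blast
qed

end

section \<open>Tilings by polyhedra\<close>

text \<open>
  Tiles may meet without sharing a face: a vertex of one tile may lie in the middle of a facet of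
  another.
\<close>

locale polyhedral_tiling =
  fixes Z :: "'e::euclidean_space set" and I :: "'i set" and P :: "'i \<Rightarrow> 'e set"
    and a :: "'i \<Rightarrow> nat \<Rightarrow> 'e" and b :: "'i \<Rightarrow> nat \<Rightarrow> real" and r :: "'i \<Rightarrow> nat"
  assumes convex_Z: "convex Z"
    and partition: "polytopic_partition Z I P"
    and P_eq: "\<And>i. i \<in> I \<Longrightarrow> P i = {z. \<forall>j\<in>{1..r i}. a i j \<bullet> z \<le> b i j}"
begin

definition tiles :: "'e \<Rightarrow> 'i set" where "tiles z = {i \<in> I. z \<in> P i}"

definition act :: "'i \<Rightarrow> 'e \<Rightarrow> nat set" where "act i z = {j \<in> {1..r i}. a i j \<bullet> z = b i j}"

lemma finite_I: "finite I"
  and Z_eq: "Z = (\<Union>i\<in>I. P i)"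
  and polytope_P: "i \<in> I \<Longrightarrow> polytope (P i)"
  and interior_P: "i \<in> I \<Longrightarrow> interior (P i) \<noteq> {}"
  using partition by (auto simp: polytopic_partition_def)

lemma closed_P: "i \<in> I \<Longrightarrow> closed (P i)"
  using polytope_P polytope_imp_closed by blast

lemma convex_P: "i \<in> I \<Longrightarrow> convex (P i)"
  using polytope_P polytope_imp_convex by blast

lemma closure_interior_P: "i \<in> I \<Longrightarrow> closure (interior (P i)) = P i"
  using convex_closure_interior[OF convex_P interior_P] closed_P by simp

lemma in_Z_iff_tiles: "z \<in> Z \<longleftrightarrow> tiles z \<noteq> {}"
  by (subst Z_eq) (auto simp: tiles_def)

lemma eventually_tiles_subset:
  "eventually (\<lambda>y. tiles y \<subseteq> tiles z) (nhds z)"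
proof -
  have "closed (\<Union>i\<in>I - tiles z. P i)" using finite_I closed_P by (intro closed_UN) auto
  then have "open (- (\<Union>i\<in>I - tiles z. P i))" by (rule open_Compl)
  moreover have "z \<in> - (\<Union>i\<in>I - tiles z. P i)" by (auto simp: tiles_def)
  ultimately have "eventually (\<lambda>y. y \<in> - (\<Union>i\<in>I - tiles z. P i)) (nhds z)"
    by (rule eventually_nhds_in_open)
  then show ?thesis by (rule eventually_mono) (auto simp: tiles_def)
qed

text \<open>
  Constraints that are strict at \<open>z\<close> stay strict nearby, so the active ones decide membership.
\<close>

lemma eventually_in_tile:
  assumes "i \<in> tiles z"
  shows "eventually (\<lambda>y. (\<forall>j\<in>act i z. a i j \<bullet> y \<le> b i j) \<longrightarrow> y \<in> P i) (nhds z)"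
proof -
  have i: "i \<in> I" and z: "\<And>j. j \<in> {1..r i} \<Longrightarrow> a i j \<bullet> z \<le> b i j"
    using assms P_eq by (auto simp: tiles_def)
  have "eventually (\<lambda>y. a i j \<bullet> y < b i j) (nhds z)" if "j \<in> {1..r i} - act i z" for j
  proof -
    have "a i j \<bullet> z < b i j" using z[of j] that by (auto simp: act_def less_le)
    moreover have "((\<lambda>y. a i j \<bullet> y) \<longlongrightarrow> a i j \<bullet> z) (nhds z)" by (intro tendsto_intros filterlim_ident)
    ultimately show ?thesis by (intro order_tendstoD)
  qed
  then have "eventually (\<lambda>y. \<forall>j\<in>{1..r i} - act i z. a i j \<bullet> y < b i j) (nhds z)"
    by (simp add: eventually_ball_finite)
  then show ?thesis
    by (rule eventually_mono) (auto simp: P_eq[OF i] less_imp_le)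
qed

lemma segment_start_in_tiles:
  assumes w: "w \<in> Z" and y: "y \<in> Z"
  obtains e where "0 < e" "e < 1" "(1 - e) *\<^sub>R w + e *\<^sub>R y \<in> Z"
    "tiles ((1 - e) *\<^sub>R w + e *\<^sub>R y) \<subseteq> tiles w"
proof -
  define q where "q e = (1 - e) *\<^sub>R w + e *\<^sub>R y" for e :: real
  have "(q \<longlongrightarrow> q 0) (at_right 0)" unfolding q_def by (intro tendsto_intros)
  then have "filterlim q (nhds w) (at_right 0)" by (simp add: q_def)
  then have "eventually (\<lambda>e. tiles (q e) \<subseteq> tiles w) (at_right 0)"
    using eventually_tiles_subset by (rule eventually_compose_filterlim[rotated])
  then have "eventually (\<lambda>e. tiles (q e) \<subseteq> tiles w \<and> 0 < e \<and> e < 1) (at_right 0)"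
    using eventually_at_right_real[of 0 1] by (auto elim: eventually_elim2)
  then obtain e where e: "tiles (q e) \<subseteq> tiles w" "0 < e" "e < 1"
    using eventually_happens'[OF trivial_limit_at_right_real] by blast
  have "q e \<in> Z" unfolding q_def using convex_Z w y e by (intro convexD) auto
  then show ?thesis using that[of e] e by (simp add: q_def)
qed

text \<open>
  The key fact about tilings. The hypothesis says that \<open>w\<close> lies in the minimal face containing \<open>z\<close>,
  for each tile through \<open>w\<close>. Such a tile absorbs directions: if the step from \<open>w\<close> towards a point
  \<open>y\<close> near \<open>z\<close> enters it, then \<open>y\<close> itself lies in it, as \<open>y\<close> respects the constraints active at \<open>z\<close>.
  Hence the tiles through \<open>w\<close> cover a neighbourhood of \<open>z\<close> in \<open>Z\<close>. Another tile containing \<open>z\<close>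
  would have interior points there, against disjointness of the interiors.
\<close>

lemma tiles_subsetI:
  assumes z: "z \<in> Z" and w: "w \<in> Z"
    and sub: "\<And>k. k \<in> tiles w \<Longrightarrow> k \<in> tiles z \<and> act k z \<subseteq> act k w"
  shows "tiles z \<subseteq> tiles w"
proof
  fix j assume j: "j \<in> tiles z"
  then have jI: "j \<in> I" and zj: "z \<in> P j" by (auto simp: tiles_def)
  have "eventually (\<lambda>y. \<forall>k\<in>tiles z. (\<forall>l\<in>act k z. a k l \<bullet> y \<le> b k l) \<longrightarrow> y \<in> P k) (nhds z)"
    using finite_I eventually_in_tile by (intro eventually_ball_finite) (auto simp: tiles_def)
  then obtain U where U: "open U" "z \<in> U"
    and U': "\<And>y k. y \<in> U \<Longrightarrow> k \<in> tiles z \<Longrightarrow> (\<forall>l\<in>act k z. a k l \<bullet> y \<le> b k l) \<Longrightarrow> y \<in> P k"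
    unfolding eventually_nhds by blast
  have "z \<in> closure (interior (P j))" using closure_interior_P[OF jI] zj by simp
  then obtain y where y: "y \<in> interior (P j)" "y \<in> U"
    using U by (meson closure_iff_nhds_not_empty disjoint_iff order_refl)
  have yZ: "y \<in> Z" using y(1) jI interior_subset Z_eq by blast
  obtain e where e: "0 < e" "e < 1" and qZ: "(1 - e) *\<^sub>R w + e *\<^sub>R y \<in> Z"
    and qw: "tiles ((1 - e) *\<^sub>R w + e *\<^sub>R y) \<subseteq> tiles w"
    using w yZ by (rule segment_start_in_tiles)
  let ?q = "(1 - e) *\<^sub>R w + e *\<^sub>R y"
  from qZ obtain k where k: "k \<in> I" "?q \<in> P k" using Z_eq by blast
  then have kw: "k \<in> tiles w" using qw by (auto simp: tiles_def)
  have "a k l \<bullet> y \<le> b k l" if l: "l \<in> act k z" for l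
  proof -
    have "a k l \<bullet> w = b k l" and lr: "l \<in> {1..r k}" using sub[OF kw] l by (auto simp: act_def)
    moreover have "a k l \<bullet> ?q \<le> b k l" using k lr P_eq by blast
    ultimately have "e * (a k l \<bullet> y) \<le> e * b k l"
      by (simp add: inner_add_right algebra_simps)
    then show ?thesis using e(1) by simp
  qed
  then have "y \<in> P k" using U' y(2) sub[OF kw] by blast
  then have "interior (P j) \<inter> closure (interior (P k)) \<noteq> {}"
    using y(1) closure_interior_P[OF k(1)] by blast
  then have "interior (P j) \<inter> interior (P k) \<noteq> {}"
    using open_Int_closure_eq_empty[OF open_interior] by blast
  then have "j = k" using partition jI k(1) unfolding polytopic_partition_def by blast
  then show "j \<in> tiles w" using kw by simp
qed

text \<open>
  If \<open>w\<close> lies in the minimal face around \<open>z\<close> for every tile through \<open>z\<close>, then the half-open segment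
  from \<open>z\<close> to \<open>w\<close> stays in the relative interiors of these faces. No new tile can show up along the
  way, by the preceding lemma with the roles exchanged: seen from \<open>y\<close>, the point \<open>z\<close> lies in
  the minimal face around \<open>y\<close>.
\<close>

lemma same_tiles_along_face:
  assumes z: "z \<in> Z"
    and w: "\<And>i. i \<in> tiles z \<Longrightarrow> w \<in> P i \<and> act i z \<subseteq> act i w"
    and t: "0 \<le> t" "t < 1"
  defines "y \<equiv> (1 - t) *\<^sub>R z + t *\<^sub>R w"
  shows "tiles y = tiles z" and "i \<in> tiles z \<Longrightarrow> act i y = act i z"
proof -
  show act: "act i y = act i z" if i: "i \<in> tiles z" for i
  proof -
    have iI: "i \<in> I" using i by (simp add: tiles_def)
    have zi: "z \<in> P i" "w \<in> P i" "act i z \<subseteq> act i w" using i w[OF i] by (auto simp: tiles_def)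
    have "a i j \<bullet> y = b i j \<longleftrightarrow> a i j \<bullet> z = b i j" if j: "j \<in> {1..r i}" for j
    proof -
      have le: "a i j \<bullet> z \<le> b i j" "a i j \<bullet> w \<le> b i j" using zi P_eq[OF iI] j by auto
      show ?thesis
      proof
        assume "a i j \<bullet> z = b i j"
        moreover from this have "a i j \<bullet> w = b i j" using zi(3) j by (auto simp: act_def)
        ultimately show "a i j \<bullet> y = b i j"
          unfolding y_def inner_add_right by (simp add: algebra_simps)
      next
        assume eq: "a i j \<bullet> y = b i j"
        have "t * (a i j \<bullet> w) \<le> t * b i j" using le(2) t(1) by (rule mult_left_mono)
        with eq have "(1 - t) * b i j \<le> (1 - t) * (a i j \<bullet> z)"
          unfolding y_def inner_add_right by (simp add: algebra_simps)
        then show "a i j \<bullet> z = b i j" using t(2) le(1) by simp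
      qed
    qed
    then show ?thesis by (auto simp: act_def)
  qed
  have yP: "y \<in> P i" if "i \<in> tiles z" for i
    using w[OF that] that t convex_P unfolding y_def by (intro convexD) (auto simp: tiles_def)
  then have sub: "tiles z \<subseteq> tiles y" by (auto simp: tiles_def)
  have "tiles z \<noteq> {}" using z Z_eq by (auto simp: tiles_def)
  then have "y \<in> Z" using yP Z_eq by (auto simp: tiles_def)
  then have "tiles y \<subseteq> tiles z"
    using sub act by (intro tiles_subsetI z) auto
  with sub show "tiles y = tiles z" by blast
qed

end

section \<open>Covers by closed sets\<close>

lemma interior_finite_Union_closed_empty:
  assumes "finite \<C>" "\<And>C. C \<in> \<C> \<Longrightarrow> closed C" "\<And>C. C \<in> \<C> \<Longrightarrow> interior C = {}"
  shows "interior (\<Union>\<C>) = {}"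
  using assms
  by (induction \<C> rule: finite_induct) (auto simp: interior_closed_Un_empty_interior)

text \<open>
  A finite union of closed sets with empty interior has empty interior and hence cannot be
  responsible for covering an open piece of \<open>X\<close>.
\<close>

lemma cover_by_nonempty_interior:
  assumes fin: "finite \<C>" and cl: "\<And>C. C \<in> \<C> \<Longrightarrow> closed C"
    and cover: "X \<subseteq> \<Union>\<C>" and reg: "X \<subseteq> closure (interior X)"
  shows "X \<subseteq> \<Union>{C \<in> \<C>. interior C \<noteq> {}}"
proof -
  let ?F = "\<Union>{C \<in> \<C>. interior C \<noteq> {}}" and ?E = "\<Union>{C \<in> \<C>. interior C = {}}"
  have F: "closed ?F" using fin cl by (intro closed_Union) auto
  have "interior X - ?F \<subseteq> ?E"
  proof
    fix x assume "x \<in> interior X - ?F"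
    moreover from this obtain C where "C \<in> \<C>" "x \<in> C" using cover interior_subset by blast
    ultimately show "x \<in> ?E" by blast
  qed
  moreover have "open (interior X - ?F)" using F by (simp add: open_Diff)
  ultimately have "interior X - ?F \<subseteq> interior ?E" by (rule interior_maximal)
  moreover have "interior ?E = {}"
    using fin cl by (intro interior_finite_Union_closed_empty) auto
  ultimately have "interior X \<subseteq> ?F" by blast
  then show ?thesis using reg closure_minimal[OF _ F] by blast
qed

section \<open>The parametric program and its critical regions\<close>

locale parametric_pwq =
  fixes Z :: "('a::euclidean_space \<times> 'b::euclidean_space) set"
    and J :: "'a \<times> 'b \<Rightarrow> real" and IZ :: "'i set" and P :: "'i \<Rightarrow> ('a \<times> 'b) set"
    and F :: "'i \<Rightarrow> 'a \<times> 'b \<Rightarrow> real"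
    and M :: "'i \<Rightarrow> nat \<Rightarrow> 'b" and N :: "'i \<Rightarrow> nat \<Rightarrow> 'a" and p :: "'i \<Rightarrow> nat \<Rightarrow> real"
    and r :: "'i \<Rightarrow> nat"
  assumes polytope_Z: "polytope Z"
    and partition: "polytopic_partition Z IZ P"
    and strict: "strictly_convex_on Z J"
    and pwq: "piecewise_quadratic_on Z IZ P J"
    and quadratic_F: "\<And>i. i \<in> IZ \<Longrightarrow> quadratic_fun (F i)"
    and F_eq_J: "\<And>i z. i \<in> IZ \<Longrightarrow> z \<in> P i \<Longrightarrow> F i z = J z"
    and P_ineq_set: "\<And>i. i \<in> IZ \<Longrightarrow> P i = ineq_set (M i) (N i) (p i) (r i)"
begin

sublocale polyhedral_tiling Z IZ P "\<lambda>i j. (- N i j, M i j)" p r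
  using polytope_Z partition P_ineq_set by unfold_locales (auto simp: polytope_imp_convex ineq_set_eq)

lemma continuous_J: "continuous_on Z J"
  using pwq by (simp add: piecewise_quadratic_on_def)

lemma compact_Z: "compact Z"
  using polytope_Z by (rule polytope_imp_compact)

lemma J_strict:
  assumes "z \<in> Z" "w \<in> Z" "z \<noteq> w" "0 < t" "t < 1"
  shows "J ((1 - t) *\<^sub>R z + t *\<^sub>R w) < (1 - t) * J z + t * J w"
  using strict assms unfolding strictly_convex_on_def by blast

lemma P_subset_Z: "i \<in> IZ \<Longrightarrow> P i \<subseteq> Z"
  using Z_eq by blast

text \<open>
  Strict convexity of \<open>J\<close> on a small ball in the interior of \<open>P i\<close>, tested on midpoints of segments
  \<open>[z0 - v, z0 + v]\<close>, says that the Hessian of \<open>F i\<close> is positive definite, and this extends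
  the strict convexity of \<open>F i\<close> to the whole space.
\<close>

lemma fibrewise_pd:
  assumes i: "i \<in> IZ"
  obtains B c where "fibrewise_pd_quadratic (F i) B c"
proof -
  obtain B c where B: "linear B"
    and ex: "\<And>z w. F i (z + w) = F i z + (B z + c) \<bullet> w + 1 / 2 * (w \<bullet> B w)"
    using quadratic_F[OF i] by (rule quadratic_fun_expansion) blast
  obtain z0 e where e: "0 < e" "cball z0 e \<subseteq> P i"
    using interior_P[OF i] by (meson all_not_in_conv mem_interior_cball)
  have pos: "0 < w \<bullet> B w" if "w \<noteq> 0" for w
  proof -
    define v where "v = (e / norm w) *\<^sub>R w"
    have v: "z0 + v \<in> P i" "z0 + - v \<in> P i" "z0 \<in> P i"
      using e that unfolding v_def by (auto intro!: subsetD[OF e(2)] simp: dist_norm)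
    have "v \<noteq> 0" using e that by (simp add: v_def)
    then have "z0 + v \<noteq> z0 + - v"
      by (metis add_left_cancel eq_neg_iff_add_eq_0 scaleR_2 scaleR_eq_0_iff zero_neq_numeral)
    then have "J ((1 - 1 / 2) *\<^sub>R (z0 + v) + (1 / 2) *\<^sub>R (z0 + - v))
        < (1 - 1 / 2) * J (z0 + v) + 1 / 2 * J (z0 + - v)"
      using v P_subset_Z[OF i] by (intro J_strict) auto
    moreover have "(1 - 1 / 2) *\<^sub>R (z0 + v) + (1 / 2) *\<^sub>R (z0 + - v) = z0"
    proof -
      have "(1 - 1 / 2) *\<^sub>R (z0 + v) + (1 / 2) *\<^sub>R (z0 + - v) = (1 / 2) *\<^sub>R ((z0 + v) + (z0 + - v))"
        by (simp only: scaleR_add_right) simp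
      also have "(z0 + v) + (z0 + - v) = z0 + z0" by simp
      finally show ?thesis by simp
    qed
    ultimately have "2 * F i z0 < F i (z0 + v) + F i (z0 + - v)"
      using v F_eq_J[OF i] by simp
    also have "\<dots> = 2 * F i z0 + v \<bullet> B v"
      unfolding ex by (simp add: linear_neg[OF B])
    finally have "0 < v \<bullet> B v" by simp
    also have "v \<bullet> B v = (e / norm w)\<^sup>2 * (w \<bullet> B w)"
      unfolding v_def by (simp add: linear_scale[OF B] power2_eq_square)
    finally show ?thesis by (simp add: zero_less_mult_iff)
  qed
  have "fibrewise_pd_quadratic (F i) B c"
  proof (rule fibrewise_pd_quadratic.intro[OF B ex])
    fix v :: 'b assume "v \<noteq> 0"
    then show "0 < (0, v) \<bullet> B (0, v)" using pos[of "(0, v)"] by (simp add: zero_prod_def)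
  qed
  then show ?thesis using that by blast
qed

abbreviation X :: "'a set" where "X \<equiv> Proj_X Z"
abbreviation \<kappa> :: "'a \<Rightarrow> 'b" where "\<kappa> \<equiv> argmin_u J Z"

lemma X_eq: "X = fst ` Z"
  by (force simp: Proj_X_def)

lemma polytope_X: "polytope X"
  unfolding X_eq using polytope_Z linear_fst by (intro polytope_linear_image)

lemma convex_X: "convex X"
  using polytope_X by (rule polytope_imp_convex)

lemma ex_sole_min:
  assumes "x \<in> X"
  shows "\<exists>u. sole_min J Z x u"
proof -
  let ?S = "Z \<inter> fst -` {x}"
  have "compact ?S" using compact_Z
    by (intro compact_Int_closed closed_vimage_fst) auto
  moreover have "?S \<noteq> {}" using assms by (auto simp: Proj_X_def)
  moreover have "continuous_on ?S J" using continuous_J by (rule continuous_on_subset) auto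
  ultimately obtain z where z: "z \<in> ?S" and min: "\<And>w. w \<in> ?S \<Longrightarrow> J z \<le> J w"
    using continuous_attains_inf[of ?S J] by blast
  obtain u where u: "z = (x, u)" using z by (cases z) auto
  have "J (x, u) < J (x, v)" if v: "(x, v) \<in> Z" "v \<noteq> u" for v
  proof -
    let ?m = "(1 - 1 / 2) *\<^sub>R (x, u) + (1 / 2) *\<^sub>R (x, v)"
    have "?m \<in> Z" using convex_Z z u v by (intro convexD) auto
    moreover have "fst ?m = x" by (simp flip: scaleR_add_left)
    ultimately have "J (x, u) \<le> J ?m" using min[of ?m] u by simp
    also have "\<dots> < (1 - 1 / 2) * J (x, u) + 1 / 2 * J (x, v)"
      using z u v by (intro J_strict) auto
    finally show ?thesis by simp
  qed
  then show ?thesis using z u by (auto simp: sole_min_def)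
qed

lemma sole_min_\<kappa>: "x \<in> X \<Longrightarrow> sole_min J Z x (\<kappa> x)"
  using ex_sole_min sole_min_argmin_u by metis

lemma min_u_eq: "x \<in> X \<Longrightarrow> min_u J Z x = J (x, \<kappa> x)"
  using sole_min_\<kappa> sole_min_min_u by metis

lemma graph_in_Z: "x \<in> X \<Longrightarrow> (x, \<kappa> x) \<in> Z"
  using sole_min_\<kappa> by (auto simp: sole_min_def)

lemma strictly_convex_value: "strictly_convex_on X (min_u J Z)"
  unfolding strictly_convex_on_def
proof (intro conjI ballI allI impI convex_X)
  fix x y and t :: real assume xy: "x \<in> X" "y \<in> X" "x \<noteq> y" and t: "0 < t" "t < 1"
  let ?z = "(1 - t) *\<^sub>R (x, \<kappa> x) + t *\<^sub>R (y, \<kappa> y)" and ?q = "(1 - t) *\<^sub>R x + t *\<^sub>R y"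
  have q: "?q \<in> X" using convex_X xy t by (intro convexD) auto
  have "?z \<in> Z" using convex_Z graph_in_Z xy t by (intro convexD) auto
  then have "min_u J Z ?q \<le> J ?z"
    using sole_min_le[OF sole_min_\<kappa>[OF q]] min_u_eq[OF q] by simp
  also have "\<dots> < (1 - t) * J (x, \<kappa> x) + t * J (y, \<kappa> y)"
    using xy t graph_in_Z by (intro J_strict) auto
  finally show "min_u J Z ?q < (1 - t) * min_u J Z x + t * min_u J Z y"
    using xy by (simp add: min_u_eq)
qed

lemma S0_eq_tiles: "S0 J Z IZ P x = tiles (x, \<kappa> x)"
  by (simp add: S0_def active_polytopes_def tiles_def)

lemma sole_min_in_tile:
  assumes "x \<in> X" "i \<in> S0 J Z IZ P x"
  shows "sole_min (F i) (P i) x (\<kappa> x)"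
proof -
  have i: "i \<in> IZ" "(x, \<kappa> x) \<in> P i" using assms(2) by (auto simp: S0_eq_tiles tiles_def)
  have "F i (x, \<kappa> x) < F i (x, v)" if "(x, v) \<in> P i" "v \<noteq> \<kappa> x" for v
    using sole_min_\<kappa>[OF assms(1)] that P_subset_Z[OF i(1)] i F_eq_J[OF i(1)]
    by (auto simp: sole_min_def)
  then show ?thesis using i by (simp add: sole_min_def)
qed

lemma active_constraints_eq_act:
  assumes "x \<in> X" "i \<in> S0 J Z IZ P x"
  shows "active_constraints (F i) (M i) (N i) (p i) (r i) x = act i (x, \<kappa> x)"
proof -
  have "i \<in> IZ" using assms(2) by (auto simp: S0_eq_tiles tiles_def)
  then have "argmin_u (F i) (ineq_set (M i) (N i) (p i) (r i)) x = \<kappa> x"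
    using sole_min_argmin_u[OF sole_min_in_tile[OF assms]] P_ineq_set by simp
  then show ?thesis by (auto simp: active_constraints_def act_def algebra_simps)
qed

text \<open>
  The active set is taken from \<open>act\<close> at the global minimizer over \<open>xb\<close>, which for
  \<open>i\<close> in \<^const>\<open>S0\<close> is the active set of the subproblem.
\<close>

definition kkt_at :: "'a \<Rightarrow> 'i \<Rightarrow> ('a \<times> 'b) set" where
  "kkt_at xb i = kkt_set (F i) (M i) (N i) (p i) (r i) (act i (xb, \<kappa> xb))"

abbreviation Xat :: "'a \<Rightarrow> 'a set" where "Xat \<equiv> X_at J Z IZ P F M N p r"

lemma S0_subset: "S0 J Z IZ P xb \<subseteq> IZ"
  by (auto simp: S0_eq_tiles tiles_def)

lemma S0_nonempty: "xb \<in> X \<Longrightarrow> S0 J Z IZ P xb \<noteq> {}"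
  using graph_in_Z[of xb] by (simp add: S0_eq_tiles in_Z_iff_tiles)

lemma act_subset: "act i z \<subseteq> {1..r i}"
  by (auto simp: act_def)

lemma X_at_eq:
  assumes "xb \<in> X"
  shows "Xat xb = (\<Inter>i\<in>S0 J Z IZ P xb. X \<inter> fst ` kkt_at xb i)"
proof -
  have "X_I X (F i) (M i) (N i) (p i) (r i)
      (active_constraints (F i) (M i) (N i) (p i) (r i) xb) = X \<inter> fst ` kkt_at xb i"
    if i: "i \<in> S0 J Z IZ P xb" for i
  proof -
    obtain B c where "fibrewise_pd_quadratic (F i) B c"
      using fibrewise_pd i S0_subset by blast
    then interpret q: fibrewise_pd_quadratic "F i" B c .
    show ?thesis unfolding active_constraints_eq_act[OF assms i] kkt_at_def
      by (rule q.X_I_eq_Proj_kkt_set[OF act_subset])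
  qed
  then show ?thesis unfolding X_at_def by (intro INF_cong) auto
qed

lemma polyhedron_kkt_at: "i \<in> IZ \<Longrightarrow> polyhedron (kkt_at xb i)"
proof -
  assume "i \<in> IZ"
  then obtain B c where "fibrewise_pd_quadratic (F i) B c" using fibrewise_pd by blast
  then interpret q: fibrewise_pd_quadratic "F i" B c .
  show ?thesis unfolding kkt_at_def
    by (rule q.polyhedron_kkt_set) (rule finite_subset[OF act_subset], simp)
qed

lemma kkt_at_subset: "i \<in> IZ \<Longrightarrow> kkt_at xb i \<subseteq> P i"
  by (auto simp: kkt_at_def kkt_set_def P_ineq_set)

lemma kkt_at_act: "z \<in> kkt_at xb i \<Longrightarrow> act i (xb, \<kappa> xb) \<subseteq> act i z"
  by (auto simp: kkt_at_def kkt_set_def eq_set_eq act_def)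

lemma kkt_at_sole_min:
  assumes "i \<in> IZ" "(x, u) \<in> kkt_at xb i"
  shows "sole_min (F i) (P i) x u"
proof -
  obtain B c where "fibrewise_pd_quadratic (F i) B c" using fibrewise_pd assms(1) by blast
  then interpret q: fibrewise_pd_quadratic "F i" B c .
  show ?thesis
    using q.kkt_set_sole_min[OF assms(2)[unfolded kkt_at_def] act_subset] P_ineq_set[OF assms(1)] by simp
qed

lemma kkt_at_self:
  assumes "xb \<in> X" "i \<in> S0 J Z IZ P xb"
  shows "(xb, \<kappa> xb) \<in> kkt_at xb i"
proof -
  have i: "i \<in> IZ" "(xb, \<kappa> xb) \<in> P i" using assms(2) by (auto simp: S0_eq_tiles tiles_def)
  obtain B c where "fibrewise_pd_quadratic (F i) B c" using fibrewise_pd i(1) by blast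
  then interpret q: fibrewise_pd_quadratic "F i" B c .
  have act: "act i (xb, \<kappa> xb) = {j \<in> {1..r i}. M i j \<bullet> \<kappa> xb = N i j \<bullet> xb + p i j}"
    by (auto simp: act_def algebra_simps)
  have "- q.G (xb, \<kappa> xb) \<in> PC (M i) (act i (xb, \<kappa> xb))"
    unfolding act
    using i P_ineq_set[OF i(1)] sole_min_le[OF sole_min_in_tile[OF assms]]
    by (intro q.kkt_necessary) auto
  then show ?thesis
    using i P_ineq_set[OF i(1)] by (auto simp: kkt_at_def kkt_set_def q.grad_u_eq act eq_set_def)
qed

lemma X_at_self: "x \<in> X \<Longrightarrow> x \<in> Xat x"
  using kkt_at_self by (force simp: X_at_eq)

lemma X_at_subset: "xb \<in> X \<Longrightarrow> Xat xb \<subseteq> X"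
  using S0_nonempty[of xb] by (auto simp: X_at_eq)

text \<open>
  Each \<open>kkt_at xb i\<close> is a polyhedron inside the polytope \<open>P i\<close>; boundedness makes its linear
  projection a polytope.
\<close>

lemma polytope_X_at:
  assumes "xb \<in> X"
  shows "polytope (Xat xb)"
proof -
  have "polyhedron (X \<inter> fst ` kkt_at xb i)" if i: "i \<in> S0 J Z IZ P xb" for i
  proof -
    have iI: "i \<in> IZ" using i S0_subset by blast
    have "polytope (P i \<inter> kkt_at xb i)"
      using polytope_P[OF iI] polyhedron_kkt_at[OF iI] by (rule polytope_Int_polyhedron)
    then have "polytope (fst ` kkt_at xb i)"
      using kkt_at_subset[OF iI, of xb] linear_fst by (auto simp: Int_absorb1 intro: polytope_linear_image)
    then show ?thesis using polytope_X by (simp add: polytope_imp_polyhedron)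
  qed
  then have "polyhedron (Xat xb)"
    unfolding X_at_eq[OF assms] using finite_subset[OF S0_subset finite_I]
    by (intro polyhedron_Inter) auto
  moreover have "bounded (Xat xb)"
    using X_at_subset[OF assms] polytope_imp_bounded[OF polytope_X] bounded_subset by blast
  ultimately show ?thesis by (simp add: polytope_eq_bounded_polyhedron)
qed

section \<open>Optimality throughout a critical region\<close>

text \<open>
  This expresses the continuity of the minimizer at \<open>xb\<close> along a segment.
  If over points tending to \<open>xb\<close> the minimizers all lay in tiles that avoid \<open>(xb, \<kappa> xb)\<close>, an
  accumulation point would be a second minimizer over \<open>xb\<close>, because along the segment the
  minimum is bounded above by the values of \<open>J\<close> between \<open>(xb, \<kappa> xb)\<close> and \<open>(x, \<kappa> x)\<close>, which tend
  to the minimum at \<open>xb\<close>.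
\<close>

lemma minimizer_tiles_along_segment:
  assumes xb: "xb \<in> X" and x: "x \<in> X"
  shows "\<exists>t. 0 < t \<and> t < 1 \<and>
    tiles ((1 - t) *\<^sub>R xb + t *\<^sub>R x, \<kappa> ((1 - t) *\<^sub>R xb + t *\<^sub>R x)) \<subseteq> tiles (xb, \<kappa> xb)"
proof (rule ccontr)
  let ?y = "\<lambda>t. (1 - t) *\<^sub>R xb + t *\<^sub>R x" and ?zb = "(xb, \<kappa> xb)"
  let ?K = "\<Union>i\<in>IZ - tiles ?zb. P i"
  assume "\<not> ?thesis"
  then have bad: "\<not> tiles (?y t, \<kappa> (?y t)) \<subseteq> tiles ?zb" if "0 < t" "t < 1" for t
    using that by blast
  define t where "t n = inverse (real (Suc (Suc n)))" for n
  have t: "0 < t n" "t n < 1" for n by (auto simp: t_def inverse_less_1_iff)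
  have t_lim: "t \<longlonglongrightarrow> 0" unfolding t_def using LIMSEQ_inverse_real_of_nat by (rule LIMSEQ_Suc)
  define w where "w n = (?y (t n), \<kappa> (?y (t n)))" for n
  have yX: "?y (t n) \<in> X" for n using convex_X xb x t[of n] by (intro convexD) auto
  have wK: "w n \<in> ?K" for n using bad[OF t] by (auto simp: w_def tiles_def)
  have "compact ?K" using finite_I polytope_P polytope_imp_compact by (intro compact_UN) auto
  then obtain l s where l: "l \<in> ?K" and s: "strict_mono s" and lim: "(w \<circ> s) \<longlonglongrightarrow> l"
    using wK unfolding compact_eq_seq_compact_metric seq_compact_def by metis
  have KZ: "?K \<subseteq> Z" using Z_eq by blast
  have ts: "(\<lambda>n. t (s n)) \<longlonglongrightarrow> 0" using LIMSEQ_subseq_LIMSEQ[OF t_lim s] by (simp add: comp_def)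
  have "(\<lambda>n. ?y (t (s n))) \<longlonglongrightarrow> (1 - 0) *\<^sub>R xb + 0 *\<^sub>R x" by (intro tendsto_intros ts)
  moreover have "(\<lambda>n. ?y (t (s n))) \<longlonglongrightarrow> fst l"
    using tendsto_fst[OF lim] by (simp add: w_def comp_def)
  ultimately have fl: "fst l = xb" using LIMSEQ_unique by fastforce
  have le: "J ((w \<circ> s) n) \<le> J ((1 - t (s n)) *\<^sub>R ?zb + t (s n) *\<^sub>R (x, \<kappa> x))" for n
  proof -
    have "(1 - t (s n)) *\<^sub>R ?zb + t (s n) *\<^sub>R (x, \<kappa> x) \<in> Z"
      using convex_Z graph_in_Z xb x t[of "s n"] by (intro convexD) auto
    then show ?thesis
      using sole_min_le[OF sole_min_\<kappa>[OF yX[of "s n"]]] by (simp add: w_def)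
  qed
  have "(\<lambda>n. J ((w \<circ> s) n)) \<longlonglongrightarrow> J l"
  proof (rule continuous_on_tendsto_compose[OF continuous_J lim])
    show "l \<in> Z" using l KZ by blast
    have "(w \<circ> s) n \<in> Z" for n using wK[of "s n"] KZ by (simp add: comp_def) blast
    then show "\<forall>\<^sub>F n in sequentially. (w \<circ> s) n \<in> Z" by simp
  qed
  moreover have "(\<lambda>n. J ((1 - t (s n)) *\<^sub>R ?zb + t (s n) *\<^sub>R (x, \<kappa> x))) \<longlonglongrightarrow> J ?zb"
  proof (rule continuous_on_tendsto_compose[OF continuous_J _ graph_in_Z[OF xb]])
    have "(\<lambda>n. (1 - t (s n)) *\<^sub>R ?zb + t (s n) *\<^sub>R (x, \<kappa> x))
        \<longlonglongrightarrow> (1 - 0) *\<^sub>R ?zb + 0 *\<^sub>R (x, \<kappa> x)"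
      by (intro tendsto_intros ts)
    then show "(\<lambda>n. (1 - t (s n)) *\<^sub>R ?zb + t (s n) *\<^sub>R (x, \<kappa> x)) \<longlonglongrightarrow> ?zb" by simp
    have "(1 - t (s n)) *\<^sub>R ?zb + t (s n) *\<^sub>R (x, \<kappa> x) \<in> Z" for n
      using convex_Z graph_in_Z xb x t[of "s n"] by (intro convexD) auto
    then show "\<forall>\<^sub>F n in sequentially. (1 - t (s n)) *\<^sub>R ?zb + t (s n) *\<^sub>R (x, \<kappa> x) \<in> Z" by simp
  qed
  ultimately have "J l \<le> J ?zb" by (rule LIMSEQ_le) (use le in blast)
  moreover obtain v where v: "l = (xb, v)" using fl by (cases l) auto
  moreover have "(xb, v) \<in> Z" using l KZ v by blast
  ultimately have "v = \<kappa> xb" using sole_min_\<kappa>[OF xb] by (auto simp: sole_min_def not_less dest!: leD)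
  then show False using l v by (auto simp: tiles_def)
qed

lemma convex_kkt_at: "i \<in> IZ \<Longrightarrow> convex (kkt_at xb i)"
  using polyhedron_kkt_at polyhedron_imp_convex by blast

text \<open>
  On the way from \<open>xb\<close> to \<open>x\<close>, the KKT points of the tiles active at \<open>xb\<close> follow segments with the
  common start \<open>\<kappa> xb\<close>. Close to \<open>xb\<close> the true minimizer \<open>w\<close> lies only in tiles active at \<open>xb\<close>, and in
  each tile through \<open>w\<close> the KKT segment passes through \<open>w\<close>, so that the constraints active at \<open>xb\<close>
  are active at \<open>w\<close>. The key fact about tilings now puts \<open>w\<close> into all
  the tiles active at \<open>xb\<close>. Thus all the segments meet in a second point, and so do not differ.
\<close>

lemma common_kkt_point:
  assumes xb: "xb \<in> X" and x: "x \<in> Xat xb"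
  obtains u where "\<And>i. i \<in> S0 J Z IZ P xb \<Longrightarrow> (x, u) \<in> kkt_at xb i"
proof -
  let ?S = "S0 J Z IZ P xb" and ?zb = "(xb, \<kappa> xb)"
  have xX: "x \<in> X" using X_at_subset xb x by blast
  have "\<forall>i\<in>?S. \<exists>u. (x, u) \<in> kkt_at xb i"
  proof
    fix i assume "i \<in> ?S"
    with x have "x \<in> fst ` kkt_at xb i" unfolding X_at_eq[OF xb] by blast
    then show "\<exists>u. (x, u) \<in> kkt_at xb i" by auto
  qed
  then obtain u where u: "\<And>i. i \<in> ?S \<Longrightarrow> (x, u i) \<in> kkt_at xb i" by metis
  obtain t where t: "0 < t" "t < 1" and
    sub: "tiles ((1 - t) *\<^sub>R xb + t *\<^sub>R x, \<kappa> ((1 - t) *\<^sub>R xb + t *\<^sub>R x)) \<subseteq> tiles ?zb"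
    using minimizer_tiles_along_segment[OF xb xX] by blast
  let ?y = "(1 - t) *\<^sub>R xb + t *\<^sub>R x"
  let ?w = "(?y, \<kappa> ?y)"
  have yX: "?y \<in> X" using convex_X xb xX t by (intro convexD) auto
  have kkt: "(?y, (1 - t) *\<^sub>R \<kappa> xb + t *\<^sub>R u i) \<in> kkt_at xb i" if i: "i \<in> ?S" for i
  proof -
    have "(1 - t) *\<^sub>R ?zb + t *\<^sub>R (x, u i) \<in> kkt_at xb i"
      using convex_kkt_at i S0_subset kkt_at_self[OF xb i] u[OF i] t by (intro convexD) auto
    then show ?thesis by simp
  qed
  have on_w: "(1 - t) *\<^sub>R \<kappa> xb + t *\<^sub>R u i = \<kappa> ?y" if i: "i \<in> ?S" "i \<in> tiles ?w" for i
  proof (rule sole_min_unique)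
    show "sole_min (F i) (P i) ?y ((1 - t) *\<^sub>R \<kappa> xb + t *\<^sub>R u i)"
      using kkt_at_sole_min kkt i S0_subset by blast
    show "sole_min (F i) (P i) ?y (\<kappa> ?y)"
      using sole_min_in_tile[OF yX] i by (simp add: S0_eq_tiles)
  qed
  have "tiles ?zb \<subseteq> tiles ?w"
  proof (rule tiles_subsetI)
    show "?zb \<in> Z" "?w \<in> Z" using graph_in_Z xb yX by auto
    fix k assume k: "k \<in> tiles ?w"
    then have kS: "k \<in> ?S" using sub by (auto simp: S0_eq_tiles)
    then show "k \<in> tiles ?zb \<and> act k ?zb \<subseteq> act k ?w"
      using kkt_at_act[OF kkt[OF kS]] on_w[OF kS k] by (simp add: S0_eq_tiles)
  qed
  then have all: "(1 - t) *\<^sub>R \<kappa> xb + t *\<^sub>R u i = \<kappa> ?y" if "i \<in> ?S" for i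
    using that on_w by (auto simp: S0_eq_tiles)
  have "u i = u j" if "i \<in> ?S" "j \<in> ?S" for i j
    using all[OF that(1)] all[OF that(2)] t by (metis add_left_cancel less_irrefl scaleR_cancel_left)
  moreover obtain i0 where "i0 \<in> ?S" using S0_nonempty[OF xb] by blast
  ultimately show ?thesis using that[of "u i0"] u by metis
qed

text \<open>
  Strictly before the end of the segment, the tiles around \<open>(y, v)\<close> are the ones active at
  \<open>xb\<close>, and \<open>v\<close> is optimal in each of them. So \<open>v\<close> is a local minimizer of \<open>J\<close> over the fibre, and
  by convexity a global one. At the end point further tiles may appear, in which nothing is known.
\<close>

lemma kkt_point_optimal_before:
  assumes xb: "xb \<in> X" and x: "x \<in> X" and u: "\<And>i. i \<in> S0 J Z IZ P xb \<Longrightarrow> (x, u) \<in> kkt_at xb i"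
    and t: "0 \<le> t" "t < 1"
  defines "y \<equiv> (1 - t) *\<^sub>R xb + t *\<^sub>R x" and "v \<equiv> (1 - t) *\<^sub>R \<kappa> xb + t *\<^sub>R u"
  shows "\<kappa> y = v"
    and "tiles (y, v) = tiles (xb, \<kappa> xb)"
    and "i \<in> tiles (xb, \<kappa> xb) \<Longrightarrow> act i (y, v) = act i (xb, \<kappa> xb)"
proof -
  let ?zb = "(xb, \<kappa> xb)"
  have yv: "(y, v) = (1 - t) *\<^sub>R ?zb + t *\<^sub>R (x, u)" by (simp add: y_def v_def)
  have face: "(x, u) \<in> P i \<and> act i ?zb \<subseteq> act i (x, u)" if "i \<in> tiles ?zb" for i
    using u[of i] that kkt_at_subset kkt_at_act by (auto simp: S0_eq_tiles tiles_def)
  show tiles: "tiles (y, v) = tiles ?zb"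
    and "i \<in> tiles ?zb \<Longrightarrow> act i (y, v) = act i ?zb"
    unfolding yv using same_tiles_along_face[OF graph_in_Z[OF xb] face t] by auto
  have min: "sole_min (F i) (P i) y v" if i: "i \<in> tiles ?zb" for i
  proof (rule kkt_at_sole_min)
    show iI: "i \<in> IZ" using i by (simp add: tiles_def)
    have "i \<in> S0 J Z IZ P xb" using i by (simp add: S0_eq_tiles)
    from kkt_at_self[OF xb this] u[OF this] show "(y, v) \<in> kkt_at xb i"
      unfolding yv using convex_kkt_at[OF iI] t by (intro convexD) auto
  qed
  have yX: "y \<in> X" unfolding y_def using convex_X xb x t by (intro convexD) auto
  have "tiles ?zb \<noteq> {}" using S0_nonempty[OF xb] by (simp add: S0_eq_tiles)
  then have vZ: "(y, v) \<in> Z" using tiles by (simp add: in_Z_iff_tiles)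
  show "\<kappa> y = v"
  proof (rule ccontr)
    assume ne: "\<kappa> y \<noteq> v"
    obtain e where e: "0 < e" "e < 1" and qZ: "(1 - e) *\<^sub>R (y, v) + e *\<^sub>R (y, \<kappa> y) \<in> Z"
      and qv: "tiles ((1 - e) *\<^sub>R (y, v) + e *\<^sub>R (y, \<kappa> y)) \<subseteq> tiles (y, v)"
      using vZ graph_in_Z[OF yX] by (rule segment_start_in_tiles)
    let ?q = "(1 - e) *\<^sub>R (y, v) + e *\<^sub>R (y, \<kappa> y)"
    obtain i where i: "i \<in> tiles ?q" using qZ in_Z_iff_tiles by blast
    have i': "i \<in> IZ" "i \<in> tiles ?zb" "(y, v) \<in> P i" "?q \<in> P i"
      using i qv tiles by (auto simp: tiles_def)
    have qe: "?q = (y, (1 - e) *\<^sub>R v + e *\<^sub>R \<kappa> y)"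
      by (simp flip: scaleR_add_left)
    have "J (y, v) \<le> J ?q"
      using sole_min_le[OF min[OF i'(2)]] i' F_eq_J[OF i'(1)] unfolding qe by metis
    also have "J ?q < (1 - e) * J (y, v) + e * J (y, \<kappa> y)"
      using vZ graph_in_Z[OF yX] ne e by (intro J_strict) auto
    also have "\<dots> \<le> (1 - e) * J (y, v) + e * J (y, v)"
      using sole_min_le[OF sole_min_\<kappa>[OF yX] vZ] e by simp
    finally show False by (simp add: algebra_simps)
  qed
qed

text \<open>
  The end point of the segment is reached by letting \<open>t\<close> tend to \<open>1\<close> in the comparison of the KKT
  segment with the segment from \<open>(xb, \<kappa> xb)\<close> to \<open>(x, \<kappa> x)\<close>.
\<close>

lemma kkt_point_optimal:
  assumes xb: "xb \<in> X" and x: "x \<in> X" and u: "\<And>i. i \<in> S0 J Z IZ P xb \<Longrightarrow> (x, u) \<in> kkt_at xb i"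
  shows "\<kappa> x = u"
proof -
  define z where "z v t = (1 - t) *\<^sub>R (xb, \<kappa> xb) + t *\<^sub>R (x, v)" for v and t :: real
  have xuZ: "(x, u) \<in> Z"
    using u S0_nonempty[OF xb] kkt_at_subset P_subset_Z S0_subset by blast
  have lim: "((\<lambda>t. J (z v t)) \<longlongrightarrow> J (x, v)) (at_left 1)" if v: "(x, v) \<in> Z" for v
  proof (rule continuous_on_tendsto_compose[OF continuous_J _ v])
    have "(z v \<longlongrightarrow> z v 1) (at_left 1)" unfolding z_def by (intro tendsto_intros)
    then show "(z v \<longlongrightarrow> (x, v)) (at_left 1)" by (simp add: z_def)
    show "\<forall>\<^sub>F t in at_left 1. z v t \<in> Z"
      using eventually_at_left_real[of 0 1, simplified]
    proof eventually_elim
      case (elim t)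
      then show ?case unfolding z_def using convex_Z graph_in_Z[OF xb] v by (intro convexD) auto
    qed
  qed
  have "\<forall>\<^sub>F t in at_left 1. J (z u t) \<le> J (z (\<kappa> x) t)"
    using eventually_at_left_real[of 0 1, simplified]
  proof eventually_elim
    case (elim t)
    let ?y = "(1 - t) *\<^sub>R xb + t *\<^sub>R x"
    have "?y \<in> X" using convex_X xb x elim by (intro convexD) auto
    moreover have "z (\<kappa> x) t \<in> Z"
      unfolding z_def using convex_Z graph_in_Z xb x elim by (intro convexD) auto
    moreover have "\<kappa> ?y = (1 - t) *\<^sub>R \<kappa> xb + t *\<^sub>R u"
      using kkt_point_optimal_before(1)[OF xb x u] elim by simp
    ultimately show ?case
      using sole_min_le[OF sole_min_\<kappa>[of ?y]] by (simp add: z_def)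
  qed
  then have "J (x, u) \<le> J (x, \<kappa> x)"
    by (rule tendsto_le[OF _ lim[OF graph_in_Z[OF x]] lim[OF xuZ], rotated]) simp
  then show ?thesis using sole_min_\<kappa>[OF x] xuZ by (auto simp: sole_min_def dest!: leD)
qed

lemma graph_in_kkt_at:
  assumes xb: "xb \<in> X" and x: "x \<in> Xat xb" and i: "i \<in> S0 J Z IZ P xb"
  shows "(x, \<kappa> x) \<in> kkt_at xb i"
proof -
  obtain u where u: "\<And>i. i \<in> S0 J Z IZ P xb \<Longrightarrow> (x, u) \<in> kkt_at xb i"
    using common_kkt_point[OF xb x] by blast
  have "x \<in> X" using X_at_subset xb x by blast
  from kkt_point_optimal[OF xb this u] show ?thesis using u[OF i] by simp
qed

text \<open>
  A region depends only on the active tiles and their active constraints, and these stay constant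
  on half-open segments that issue from \<open>xb\<close>.
\<close>

lemma X_at_segment:
  assumes xb: "xb \<in> X" and x: "x \<in> Xat xb" and t: "0 \<le> t" "t < 1"
  shows "Xat ((1 - t) *\<^sub>R xb + t *\<^sub>R x) = Xat xb"
proof -
  let ?y = "(1 - t) *\<^sub>R xb + t *\<^sub>R x"
  have xX: "x \<in> X" using X_at_subset xb x by blast
  have yX: "?y \<in> X" using convex_X xb xX t by (intro convexD) auto
  note * = kkt_point_optimal_before[OF xb xX graph_in_kkt_at[OF xb x] t]
  have "S0 J Z IZ P ?y = S0 J Z IZ P xb" using *(1,2) by (simp add: S0_eq_tiles)
  moreover have "kkt_at ?y i = kkt_at xb i" if "i \<in> S0 J Z IZ P xb" for i
    using *(1) *(3)[of i] that by (simp add: kkt_at_def S0_eq_tiles)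
  ultimately show ?thesis using X_at_eq[OF xb] X_at_eq[OF yX] by simp
qed

text \<open>
  The segment from \<open>xb\<close> to an interior point can be prolonged inside the region, so that the point
  is not its end. It follows that regions with overlapping interiors coincide.
\<close>

lemma X_at_interior:
  assumes xb: "xb \<in> X" and y: "y \<in> interior (Xat xb)"
  shows "Xat y = Xat xb"
proof (cases "y = xb")
  case False
  obtain e where e: "0 < e" "ball y e \<subseteq> Xat xb" using y by (auto simp: mem_interior)
  \<comment> \<open>With this \<open>s\<close> the prolonged point \<open>x\<close> has distance \<open>e / 2\<close> from \<open>y\<close>.\<close>
  define s where "s = e / (2 * norm (y - xb))"
  have s: "0 < s" using e False by (simp add: s_def)
  define x where "x = y + s *\<^sub>R (y - xb)"
  have "x \<in> Xat xb"
    using e(1) False by (intro subsetD[OF e(2)]) (simp add: x_def s_def dist_norm)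
  moreover define t where "t = 1 / (1 + s)"
  moreover have "y = (1 - t) *\<^sub>R xb + t *\<^sub>R x"
  proof -
    have ts: "t * (1 + s) = 1" using s by (simp add: t_def)
    have "t *\<^sub>R x = (t * (1 + s)) *\<^sub>R y - (t * s) *\<^sub>R xb"
      by (simp add: x_def algebra_simps)
    moreover have "t * s = 1 - t" using ts by (simp add: algebra_simps)
    ultimately have "t *\<^sub>R x = y - (1 - t) *\<^sub>R xb" using ts by simp
    then show ?thesis by simp
  qed
  ultimately show ?thesis using X_at_segment[OF xb, of x t] s by (simp add: t_def)
qed simp

section \<open>The partition into critical regions\<close>

lemma sole_min_in_tile_X_at:
  assumes "xb \<in> X" "x \<in> Xat xb" "i \<in> S0 J Z IZ P xb"
  shows "sole_min (F i) (P i) x (\<kappa> x)"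
  using kkt_at_sole_min graph_in_kkt_at[OF assms] S0_subset assms(3) by blast

lemma minimizer_affine_on_X_at:
  assumes xb: "xb \<in> X"
  obtains g where "affine_fun g" "\<And>x. x \<in> Xat xb \<Longrightarrow> \<kappa> x = g x"
proof -
  obtain i where i: "i \<in> S0 J Z IZ P xb" using S0_nonempty[OF xb] by blast
  then obtain B c where "fibrewise_pd_quadratic (F i) B c" using fibrewise_pd S0_subset by blast
  then interpret q: fibrewise_pd_quadratic "F i" B c .
  have "finite (act i (xb, \<kappa> xb))" by (rule finite_subset[OF act_subset]) simp
  then obtain g where g: "affine_fun g" "\<And>x u. (x, u) \<in> kkt_at xb i \<Longrightarrow> u = g x"
    unfolding kkt_at_def by (rule q.kkt_set_affine_graph) blast
  show ?thesis using that[OF g(1)] g(2) graph_in_kkt_at[OF xb _ i] by blast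
qed

lemma value_quadratic_on_X_at:
  assumes xb: "xb \<in> X"
  obtains h where "quadratic_fun h" "\<And>x. x \<in> Xat xb \<Longrightarrow> min_u J Z x = h x"
proof -
  obtain i where i: "i \<in> S0 J Z IZ P xb" using S0_nonempty[OF xb] by blast
  then have iI: "i \<in> IZ" using S0_subset by blast
  obtain g where g: "affine_fun g" and \<kappa>: "\<And>x. x \<in> Xat xb \<Longrightarrow> \<kappa> x = g x"
    using xb by (rule minimizer_affine_on_X_at) blast
  obtain K k where K: "linear K" "\<And>x. g x = K x + k" using g unfolding affine_fun_def by blast
  have "linear (\<lambda>x. (x, K x))" using K(1) by (intro linearI) (simp_all add: linear_add linear_scale)
  then have "quadratic_fun (\<lambda>x. F i ((x, K x) + (0, k)))"
    using quadratic_F[OF iI] by (intro quadratic_fun_affine_compose)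
  moreover have "min_u J Z x = F i ((x, K x) + (0, k))" if x: "x \<in> Xat xb" for x
  proof -
    have "(x, \<kappa> x) \<in> P i" using sole_min_in_tile_X_at[OF xb x i] by (simp add: sole_min_def)
    then have "J (x, \<kappa> x) = F i (x, \<kappa> x)" using F_eq_J[OF iI] by simp
    moreover have "x \<in> X" using X_at_subset xb x by blast
    ultimately show ?thesis using \<kappa>[OF x] K(2) by (simp add: min_u_eq)
  qed
  ultimately show ?thesis using that by blast
qed

text \<open>
  A region is determined by a set of tiles together with a set of constraints for each tile.
\<close>

lemma finite_X_at_image: "finite (Xat ` X)"
proof -
  define \<Phi> where "\<Phi> = (\<lambda>(S, A). \<Inter>i\<in>S. X_I X (F i) (M i) (N i) (p i) (r i) (A i))"
  define D where "D = Pow IZ \<times> (\<Pi>\<^sub>E i\<in>IZ. Pow {1..r i})"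
  have "Xat ` X \<subseteq> \<Phi> ` D"
  proof (rule image_subsetI)
    fix x assume "x \<in> X"
    let ?A = "\<lambda>i\<in>IZ. active_constraints (F i) (M i) (N i) (p i) (r i) x"
    have "(S0 J Z IZ P x, ?A) \<in> D"
      using S0_subset by (auto simp: D_def active_constraints_def)
    moreover have "Xat x = \<Phi> (S0 J Z IZ P x, ?A)"
      unfolding X_at_def \<Phi>_def using S0_subset[of x] by (auto intro!: INF_cong)
    ultimately show "Xat x \<in> \<Phi> ` D" by blast
  qed
  moreover have "finite D" unfolding D_def using finite_I by (auto intro!: finite_PiE)
  ultimately show ?thesis using finite_subset by blast
qed

lemma affine_fun_continuous_on: "affine_fun g \<Longrightarrow> continuous_on S g"
  unfolding affine_fun_def
  by (metis (no_types, lifting) continuous_on_add continuous_on_const continuous_on_eq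
      linear_continuous_on linear_conv_bounded_linear)

lemma continuous_minimizer: "continuous_on X \<kappa>"
proof -
  have "continuous_on (\<Union>C\<in>Xat ` X. C) \<kappa>"
  proof (rule continuous_on_closed_Union[OF finite_X_at_image])
    fix C assume "C \<in> Xat ` X"
    then obtain xb where C: "C = Xat xb" and xb: "xb \<in> X" by blast
    show "closed C" unfolding C using polytope_X_at[OF xb] by (rule polytope_imp_closed)
    obtain g where g: "affine_fun g" "\<And>x. x \<in> Xat xb \<Longrightarrow> \<kappa> x = g x"
      using xb by (rule minimizer_affine_on_X_at) blast
    then show "continuous_on C \<kappa>"
      unfolding C using affine_fun_continuous_on[OF g(1)] by (simp cong: continuous_on_cong)
  qed
  moreover have "X \<subseteq> (\<Union>C\<in>Xat ` X. C)" using X_at_self by auto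
  ultimately show ?thesis by (rule continuous_on_subset)
qed

lemma continuous_value: "continuous_on X (min_u J Z)"
proof -
  have "continuous_on X (\<lambda>x. J (x, \<kappa> x))"
    by (rule continuous_on_compose2[OF continuous_J])
      (use continuous_minimizer graph_in_Z in \<open>auto intro!: continuous_intros\<close>)
  then show ?thesis by (simp add: min_u_eq cong: continuous_on_cong)
qed

lemma X_regular: "X \<subseteq> closure (interior X)"
proof (cases "IZ = {}")
  case True
  then have "X = {}" using Z_eq by (simp add: Proj_X_def)
  then show ?thesis by simp
next
  case False
  then obtain i where i: "i \<in> IZ" by blast
  have "fst ` interior (P i) \<subseteq> X"
    unfolding X_eq using interior_subset P_subset_Z[OF i] by blast
  moreover have "open (fst ` interior (P i))" by (rule open_image_fst) simp
  ultimately have "fst ` interior (P i) \<subseteq> interior X" by (rule interior_maximal)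
  then have "interior X \<noteq> {}" using interior_P[OF i] by blast
  then show ?thesis using convex_closure_interior[OF convex_X] closure_subset by blast
qed

text \<open>
  Lower-dimensional regions occur, for example at points where several tiles meet in a vertex,
  and have no place in a polytopic partition.
\<close>

definition regions :: "'a set set" where "regions = {C \<in> Xat ` X. interior C \<noteq> {}}"

lemma Union_regions: "\<Union>regions = X"
proof
  show "\<Union>regions \<subseteq> X" using X_at_subset by (auto simp: regions_def)
  show "X \<subseteq> \<Union>regions" unfolding regions_def
  proof (rule cover_by_nonempty_interior[OF finite_X_at_image _ _ X_regular])
    show "closed C" if "C \<in> Xat ` X" for C
      using that polytope_X_at polytope_imp_closed by blast
    show "X \<subseteq> \<Union>(Xat ` X)" using X_at_self by blast
  qed
qed

lemma disjoint_regions: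
  assumes "C \<in> regions" "D \<in> regions" "C \<noteq> D"
  shows "interior C \<inter> interior D = {}"
proof (rule ccontr)
  assume "interior C \<inter> interior D \<noteq> {}"
  then obtain y where y: "y \<in> interior C" "y \<in> interior D" by blast
  obtain xb xb' where xb: "xb \<in> X" "C = Xat xb" and xb': "xb' \<in> X" "D = Xat xb'"
    using assms(1,2) by (auto simp: regions_def)
  have "C = Xat y" using X_at_interior[OF xb(1)] y(1) xb(2) by simp
  also have "Xat y = D" using X_at_interior[OF xb'(1)] y(2) xb'(2) by simp
  finally show False using assms(3) by simp
qed

lemma V_at_eq:
  assumes "xb \<in> X" "x \<in> Xat xb" "i \<in> S0 J Z IZ P xb"
  shows "V_at J Z IZ P F xb x = min_u J Z x" and "min_u (F i) (P i) x = min_u J Z x"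
proof -
  have xX: "x \<in> X" using X_at_subset assms by blast
  have eq: "min_u (F i) (P i) x = min_u J Z x" if i: "i \<in> S0 J Z IZ P xb" for i
  proof -
    have iI: "i \<in> IZ" using i S0_subset by blast
    have sole: "sole_min (F i) (P i) x (\<kappa> x)" using sole_min_in_tile_X_at[OF assms(1,2) i] .
    then have "(x, \<kappa> x) \<in> P i" by (simp add: sole_min_def)
    then show ?thesis using sole_min_min_u[OF sole] F_eq_J[OF iI] min_u_eq[OF xX] by simp
  qed
  then show "min_u (F i) (P i) x = min_u J Z x" using assms(3) .
  show "V_at J Z IZ P F xb x = min_u J Z x"
    unfolding V_at_def using eq assms(3) by (intro the_equality) auto
qed

lemma kappa_at_eq:
  assumes "xb \<in> X" "x \<in> Xat xb" "i \<in> S0 J Z IZ P xb"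
  shows "kappa_at J Z IZ P F xb x = \<kappa> x" and "argmin_u (F i) (P i) x = \<kappa> x"
proof -
  have eq: "argmin_u (F i) (P i) x = \<kappa> x" if "i \<in> S0 J Z IZ P xb" for i
    using sole_min_in_tile_X_at[OF assms(1,2) that] by (rule sole_min_argmin_u)
  then show "argmin_u (F i) (P i) x = \<kappa> x" using assms(3) .
  show "kappa_at J Z IZ P F xb x = \<kappa> x"
    unfolding kappa_at_def using eq assms(3) by (intro the_equality) auto
qed

lemma regions_enumeration:
  obtains IX :: "nat set" and PX where "bij_betw PX IX regions"
    "polytopic_partition X IX PX"
    "piecewise_quadratic_on X IX PX (min_u J Z)"
    "piecewise_affine_on X IX PX \<kappa>"
proof -
  have fin: "finite regions" using finite_X_at_image by (simp add: regions_def)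
  then obtain PX where PX: "bij_betw PX {0..<card regions} regions"
    using ex_bij_betw_nat_finite by blast
  let ?I = "{0..<card regions}"
  have mem: "PX k \<in> regions" if "k \<in> ?I" for k
    using bij_betwE[OF PX] that by blast
  then have reg: "\<exists>xb\<in>X. PX k = Xat xb" "interior (PX k) \<noteq> {}" if "k \<in> ?I" for k
    using that unfolding regions_def by blast+
  have "polytopic_partition X ?I PX"
    unfolding polytopic_partition_def
  proof (intro conjI ballI impI)
    show "compact X" using polytope_X by (rule polytope_imp_compact)
    show "polytope (PX k)" "interior (PX k) \<noteq> {}" if "k \<in> ?I" for k
      using reg[OF that] polytope_X_at by auto
    show "interior (PX k) \<inter> interior (PX l) = {}" if "k \<in> ?I" "l \<in> ?I" "k \<noteq> l" for k l
      using that mem inj_onD[OF bij_betw_imp_inj_on[OF PX]] by (intro disjoint_regions) blast+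
    show "X = (\<Union>k\<in>?I. PX k)" using Union_regions bij_betw_imp_surj_on[OF PX] by simp
  qed simp
  moreover have "piecewise_quadratic_on X ?I PX (min_u J Z)"
    unfolding piecewise_quadratic_on_def
    using continuous_value reg(1) value_quadratic_on_X_at by metis
  moreover have "piecewise_affine_on X ?I PX \<kappa>"
    unfolding piecewise_affine_on_def
    using continuous_minimizer reg(1) minimizer_affine_on_X_at by metis
  ultimately show ?thesis using that PX by blast
qed

end

theorem theorem1:
  fixes Z :: "((real ^ 'n) \<times> (real ^ 'm)) set"
    and J :: "(real ^ 'n) \<times> (real ^ 'm) \<Rightarrow> real"
    and IZ :: "'i set"
    and P :: "'i \<Rightarrow> ((real ^ 'n) \<times> (real ^ 'm)) set"
    and F :: "'i \<Rightarrow> (real ^ 'n) \<times> (real ^ 'm) \<Rightarrow> real"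
    and M :: "'i \<Rightarrow> nat \<Rightarrow> real ^ 'm"
    and N :: "'i \<Rightarrow> nat \<Rightarrow> real ^ 'n"
    and p :: "'i \<Rightarrow> nat \<Rightarrow> real"
    and r :: "'i \<Rightarrow> nat"
  assumes "polytope Z"
    and "polytopic_partition Z IZ P"
    and "strictly_convex_on Z J"
    and "piecewise_quadratic_on Z IZ P J"
    and "\<And>i. i \<in> IZ \<Longrightarrow> quadratic_fun (F i)"
    and "\<And>i z. i \<in> IZ \<Longrightarrow> z \<in> P i \<Longrightarrow> F i z = J z"
    and "\<And>i. i \<in> IZ \<Longrightarrow> P i = ineq_set (M i) (N i) (p i) (r i)"
  shows "(\<forall>x\<in>Proj_X Z. \<exists>!u. is_arg_min (\<lambda>u. J (x, u)) (\<lambda>u. (x, u) \<in> Z) u) \<and>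
    strictly_convex_on (Proj_X Z) (min_u J Z) \<and>
    (\<exists>(IX :: nat set) PX.
      polytopic_partition (Proj_X Z) IX PX \<and>
      piecewise_quadratic_on (Proj_X Z) IX PX (min_u J Z) \<and>
      piecewise_affine_on (Proj_X Z) IX PX (argmin_u J Z) \<and>
      (\<forall>k\<in>IX.
        (\<exists>xb\<in>Proj_X Z. PX k = X_at J Z IZ P F M N p r xb) \<and>
        (\<forall>xb\<in>Proj_X Z. PX k = X_at J Z IZ P F M N p r xb \<longrightarrow>
          (\<forall>x\<in>X_at J Z IZ P F M N p r xb.
            (\<forall>i\<in>S0 J Z IZ P xb. x \<in> Proj_X (P i) \<and>
              V_at J Z IZ P F xb x = min_u (F i) (P i) x \<and>
              kappa_at J Z IZ P F xb x = argmin_u (F i) (P i) x) \<and>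
            min_u J Z x = V_at J Z IZ P F xb x \<and>
            argmin_u J Z x = kappa_at J Z IZ P F xb x))))"
proof -
  interpret parametric_pwq Z J IZ P F M N p r
    using assms by unfold_locales
  have unique: "\<forall>x\<in>Proj_X Z. \<exists>!u. is_arg_min (\<lambda>u. J (x, u)) (\<lambda>u. (x, u) \<in> Z) u"
    using sole_min_is_arg_min[OF sole_min_\<kappa>] by simp
  obtain IX :: "nat set" and PX where PX: "bij_betw PX IX regions"
    and pieces: "polytopic_partition X IX PX" "piecewise_quadratic_on X IX PX (min_u J Z)"
      "piecewise_affine_on X IX PX \<kappa>"
    by (rule regions_enumeration)
  have "\<exists>xb\<in>X. PX k = Xat xb" if "k \<in> IX" for k
  proof -
    have "PX k \<in> regions" using bij_betwE[OF PX] that by blast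
    then show ?thesis unfolding regions_def by blast
  qed
  moreover have "(\<forall>i\<in>S0 J Z IZ P xb. x \<in> Proj_X (P i) \<and>
        V_at J Z IZ P F xb x = min_u (F i) (P i) x \<and>
        kappa_at J Z IZ P F xb x = argmin_u (F i) (P i) x) \<and>
      min_u J Z x = V_at J Z IZ P F xb x \<and> \<kappa> x = kappa_at J Z IZ P F xb x"
    if xb: "xb \<in> X" "x \<in> Xat xb" for xb x
  proof -
    obtain i where "i \<in> S0 J Z IZ P xb" using S0_nonempty[OF xb(1)] by blast
    note * = V_at_eq(1)[OF xb this] kappa_at_eq(1)[OF xb this]
    have "x \<in> Proj_X (P i)" if "i \<in> S0 J Z IZ P xb" for i
      using sole_min_in_tile_X_at[OF xb that] by (auto simp: sole_min_def Proj_X_def)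
    then show ?thesis using * V_at_eq(2)[OF xb] kappa_at_eq(2)[OF xb] by simp
  qed
  ultimately show ?thesis using unique strictly_convex_value pieces by blast
qed

end
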